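(* Let $\lambda>0$ and $0<\alpha\le1$. The one-dimensional distributions of $\{\hat N_\alpha(t)\}_{t\ge0}$, i.e. the distributions of the random variables $\hat N_\alpha(t)$, $t>0$, are not infinitely divisible.
   Context: Three-parameter Mittag-Leffler function: $E_{\alpha,\beta}^{\gamma}(x)=\frac{1}{\Gamma(\gamma)}\sum_{j=0}^\infty\frac{\Gamma(j+\gamma)x^j}{j!\,\Gamma(j\alpha+\beta)}$ for $\alpha,\beta,\gamma>0$, $x\in\mathbb R$. For $\lambda>0$ and $0<\alpha\le1$, $\{\hat N_\alpha(t)\}_{t\ge0}$ is the renewal counting process with $\hat N_\alpha(0)=0$ whose i.i.d. interarrival times have density $\lambda^2t^{2\alpha-1}E^2_{\alpha,2\alpha}(-\lambda t^\alpha)$, $t>0$. Its probability mass function is, for $n\ge0$, $$\Pr\{\hat N_\alpha(t)=n\}=\lambda^{2n}t^{2n\alpha}E_{\alpha,2n\alpha+1}^{2n+1}(-\lambda t^\alpha)+\lambda^{2n+1}t^{(2n+1)\alpha}E_{\alpha,(2n+1)\alpha+1}^{2n+2}(-\lambda t^\alpha).$$ *)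

theory Defs
  imports "HOL-Probability.Probability"
begin

definition mittag_leffler3 :: "real \<Rightarrow> real \<Rightarrow> real \<Rightarrow> real \<Rightarrow> real" where
  "mittag_leffler3 \<alpha> \<beta> \<gamma> x =
     1 / Gamma \<gamma> * (\<Sum>j. Gamma (real j + \<gamma>) * x ^ j / (fact j * Gamma (real j * \<alpha> + \<beta>)))"

definition interarrival_density :: "real \<Rightarrow> real \<Rightarrow> real \<Rightarrow> real" where
  "interarrival_density lam \<alpha> s =
     (if s > 0 then lam\<^sup>2 * s powr (2 * \<alpha> - 1) * mittag_leffler3 \<alpha> (2 * \<alpha>) 2 (- lam * s powr \<alpha>) else 0)"

text \<open>
  The number of renewal epochs in \<open>(0, t]\<close>. Here \<open>T i\<close> is the waiting time between the
  \<open>i\<close>-th and the \<open>(i + 1)\<close>-st renewal epoch (the 0-th being the time origin, which is not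
  counted), so the \<open>n\<close>-th epoch is the sum of the first \<open>n\<close> waiting times. For i.i.d. waiting
  times with a density supported on the positive half-line the set is almost surely finite;
  on the exceptional null set \<open>card\<close> returns 0.
\<close>

definition renewal_count :: "(nat \<Rightarrow> 'a \<Rightarrow> real) \<Rightarrow> real \<Rightarrow> 'a \<Rightarrow> nat" where
  "renewal_count T t \<omega> = card {n. n \<ge> 1 \<and> (\<Sum>i<n. T i \<omega>) \<le> t}"

lemma renewal_count_0:
  assumes "\<And>i. T i \<omega> > 0"
  shows "renewal_count T 0 \<omega> = 0"
proof -
  have "(\<Sum>i<n. T i \<omega>) > 0" if "n \<ge> 1" for n
    using that assms by (intro sum_pos) (auto simp: lessThan_empty_iff)
  then have "{n. n \<ge> 1 \<and> (\<Sum>i<n. T i \<omega>) \<le> 0} = {}"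
    using leD by blast
  then show ?thesis
    by (simp only: renewal_count_def card.empty)
qed

text \<open>
  The law of a real random variable is infinitely divisible if, for each \<open>n \<ge> 1\<close>, it is the law
  of a sum of \<open>n\<close> i.i.d. real random variables with some common law \<open>\<nu>\<close>; these are realised as
  the coordinates of the \<open>n\<close>-fold product of \<open>\<nu>\<close>.
\<close>

definition infinitely_divisible :: "real measure \<Rightarrow> bool" where
  "infinitely_divisible \<mu> \<longleftrightarrow>
     (\<forall>n\<ge>1. \<exists>\<nu>. real_distribution \<nu> \<and>
        \<mu> = distr (Pi\<^sub>M {..<n::nat} (\<lambda>_. \<nu>)) borel (\<lambda>x. \<Sum>i<n. x i))"

end

theory Submission
  imports Defs "HOL-Complex_Analysis.Complex_Analysis" "HOL-Real_Asymp.Real_Asymp"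
begin

text \<open>
  Put \<open>x = lam * t powr \<alpha>\<close>, let \<open>E y = (\<Sum>j. y ^ j / Gamma (1 + \<alpha> j))\<close> be the one-parameter
  Mittag-Leffler function, and let \<open>p k\<close> be the coefficients of \<open>z ^ k\<close> in \<open>E (x * (z - 1))\<close>:
  the law at time \<open>t\<close> of the fractional Poisson process, whose waiting times have Laplace
  transform \<open>lam / (lam + s powr \<alpha>)\<close>. The waiting times considered here have the square of that
  transform, so every second event of the fractional Poisson process is counted, and the value
  \<open>n\<close> has probability \<open>q n = p (2 n) + p (2 n + 1)\<close> (\<open>prob_renewal_count\<close>).

  Suppose that this law is infinitely divisible. It lives on the natural numbers and charges 0, so
  for each \<open>n\<close> its generating function \<open>Q\<close> is the \<open>n\<close>-th power of a generating function; letting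
  \<open>n\<close> tend to infinity, \<open>Q' / Q\<close> has nonnegative coefficients
  (\<open>infinitely_divisible_log_derivative_nonneg\<close>). These coefficients are dominated by those of
  \<open>Q' / q 0\<close>, and \<open>Q\<close> is entire. Hence \<open>Q z = q 0 * exp (P z)\<close> on the whole real line, where \<open>P\<close>
  is an everywhere convergent power series with nonnegative coefficients
  (\<open>power_series_eq_exp\<close>).

  The growth of \<open>Q\<close> contradicts this. Let \<open>\<beta> = 1 / \<alpha>\<close> and \<open>\<kappa> = x powr \<beta>\<close>. For \<open>w \<ge> 1\<close>, pairing
  the coefficients of \<open>E (x * (w - 1))\<close> shows that this number lies between \<open>Q (w ^ 2)\<close> and
  \<open>w * Q (w ^ 2)\<close>, and \<open>ln (E y)\<close> is \<open>y powr \<beta>\<close> up to a logarithmic error. Therefore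
  \<open>P (w ^ 2) = \<kappa> * (w - 1) powr \<beta> + O (ln w)\<close>. The upper bound leaves in \<open>P (w ^ 2)\<close> only even
  powers of \<open>w\<close> with exponent at most \<open>\<beta>\<close>, so \<open>P (w ^ 2) / w powr \<beta>\<close> is nonincreasing. As it
  tends to \<open>\<kappa>\<close>, it is at least \<open>\<kappa>\<close> everywhere. If \<open>\<beta> < 2\<close>, no power is left and \<open>P\<close> vanishes,
  which is absurd. If \<open>\<beta> \<ge> 2\<close>, the bound \<open>\<kappa> * w powr \<beta> \<le> \<kappa> * (w - 1) powr \<beta> + O (ln w)\<close> fails
  for large \<open>w\<close>, because \<open>w powr \<beta>\<close> exceeds \<open>(w - 1) powr \<beta>\<close> by at least \<open>w powr (\<beta> - 1)\<close>.

  Two facts about the process come first. All \<open>p k\<close> are nonnegative, that is, \<open>E\<close> is completely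
  monotone on the negative half-line (\<open>fpp_pmf_nonneg\<close>); this also makes the interarrival density
  nonnegative, and it is what the pairing of coefficients rests on. The distribution of the
  partial sums of waiting times is computed by convolving power series in \<open>t powr \<alpha>\<close> term by term
  with Beta integrals, which turns convolution into multiplication of formal power series
  (\<open>frac_convolution\<close>, \<open>prob_sum_le\<close>).
\<close>

section \<open>Growth of the Mittag-Leffler function\<close>

definition ml_coeff :: "real \<Rightarrow> nat \<Rightarrow> real" where
  "ml_coeff \<alpha> j = 1 / Gamma (1 + \<alpha> * real j)"

definition ml :: "real \<Rightarrow> real \<Rightarrow> real" where
  "ml \<alpha> y = (\<Sum>j. y ^ j * ml_coeff \<alpha> j)"

lemma ml_coeff_pos: "\<alpha> > 0 \<Longrightarrow> ml_coeff \<alpha> j > 0"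
  by (auto simp: ml_coeff_def intro!: divide_pos_pos Gamma_real_pos add_pos_nonneg)

lemma Gamma_real_mono_2:
  fixes x y :: real
  assumes "2 \<le> x" "x \<le> y"
  shows "Gamma x \<le> Gamma y"
  using Gamma_real_strict_mono[of x y] assms by (cases "x = y") auto

text \<open>
  Up to factors that are polynomial in \<open>n\<close>, Gamma on a unit interval is a factorial. This is all
  that is needed to compare the Mittag-Leffler series with the exponential series.
\<close>

lemma Gamma_floor_bounds:
  fixes u :: real
  assumes "real n \<le> u" "u \<le> real n + 1"
  shows "fact n / 2 \<le> Gamma (1 + u)" and "Gamma (1 + u) \<le> fact (n + 2)"
proof -
  have shift: "Gamma (2 + u) = (1 + u) * Gamma (1 + u)"
  proof -
    have "1 + u \<notin> \<int>\<^sub>\<le>\<^sub>0"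
      using assms nonpos_Ints_nonpos[of "1 + u"] by linarith
    from Gamma_plus1[OF this] show ?thesis by (simp add: add_ac)
  qed
  have pos: "Gamma (1 + u) > 0"
    using assms by (intro Gamma_real_pos) linarith
  have lo: "fact (Suc n) \<le> Gamma (2 + u)"
    using Gamma_real_mono_2[of "2 + real n" "2 + u"] assms Gamma_fact[of "Suc n", where 'a = real]
    by (simp add: add_ac)
  have hi: "Gamma (2 + u) \<le> fact (n + 2)"
    using Gamma_real_mono_2[of "2 + u" "3 + real n"] assms Gamma_fact[of "n + 2", where 'a = real]
    by (simp add: add_ac)
  have "(real n + 1) * fact n \<le> (1 + u) * Gamma (1 + u)"
    using lo shift by (simp add: add.commute)
  also have "\<dots> \<le> (real n + 2) * Gamma (1 + u)"
    using assms pos by (intro mult_right_mono) auto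
  also have "\<dots> \<le> (2 * (real n + 1)) * Gamma (1 + u)"
    using pos by (intro mult_right_mono) auto
  finally have "(real n + 1) * fact n \<le> (real n + 1) * (2 * Gamma (1 + u))"
    by (simp add: algebra_simps)
  then show "fact n / 2 \<le> Gamma (1 + u)"
    by (subst (asm) mult_le_cancel_left_pos) auto
  have "1 * Gamma (1 + u) \<le> (1 + u) * Gamma (1 + u)"
    using assms pos by (intro mult_right_mono) auto
  then show "Gamma (1 + u) \<le> fact (n + 2)"
    using hi shift by simp
qed

text \<open>
  Put \<open>y = t powr \<alpha>\<close>, so that the \<open>j\<close>-th term is \<open>t powr u / Gamma (1 + u)\<close> with \<open>u = \<alpha> j\<close>. It is at
  most twice \<open>t\<close> times the exponential term of index \<open>\<lfloor>u\<rfloor>\<close>, and every index is hit by at most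
  \<open>\<lceil>1 / \<alpha>\<rceil>\<close> values of \<open>j\<close>. Besides the growth of \<open>ml\<close>, this gives the convergence of all series
  that have the Mittag-Leffler coefficients as a factor.
\<close>

lemma ml_partial_sum_le:
  fixes \<alpha> t :: real
  assumes "\<alpha> > 0" "t \<ge> 1"
  shows "(\<Sum>j<J. (t powr \<alpha>) ^ j * ml_coeff \<alpha> j) \<le> real (nat \<lceil>1 / \<alpha>\<rceil>) * (2 * t * exp t)"
proof -
  define v where "v n = 2 * t * (t ^ n / fact n)" for n
  define fl where "fl j = nat \<lfloor>\<alpha> * real j\<rfloor>" for j
  define K where "K = nat \<lceil>1 / \<alpha>\<rceil>"
  have v_nonneg: "v n \<ge> 0" for n
    using assms by (simp add: v_def)
  have fl: "real (fl j) \<le> \<alpha> * real j" "\<alpha> * real j < real (fl j) + 1" for j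
    using assms by (simp_all add: fl_def)
  have term_le: "(t powr \<alpha>) ^ j * ml_coeff \<alpha> j \<le> v (fl j)" for j
  proof -
    have "(t powr \<alpha>) ^ j = t powr (\<alpha> * real j)"
      using assms by (simp add: powr_realpow [symmetric] powr_powr)
    also have "\<dots> \<le> t powr (real (fl j + 1))"
      using assms fl[of j] by (intro powr_mono) auto
    also have "\<dots> = t ^ (fl j + 1)"
      using assms by (subst powr_realpow) auto
    finally have 1: "(t powr \<alpha>) ^ j \<le> t ^ (fl j + 1)" .
    have "ml_coeff \<alpha> j \<le> 1 / (fact (fl j) / 2)"
      unfolding ml_coeff_def using fl[of j] Gamma_floor_bounds(1)[of "fl j" "\<alpha> * real j"]
      by (intro divide_left_mono mult_pos_pos Gamma_real_pos) (auto intro: add_pos_nonneg)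
    then have "(t powr \<alpha>) ^ j * ml_coeff \<alpha> j \<le> t ^ (fl j + 1) * (1 / (fact (fl j) / 2))"
      using 1 assms ml_coeff_pos[of \<alpha> j] by (intro mult_mono) auto
    then show ?thesis by (simp add: v_def mult_ac)
  qed
  have fibre: "card {j \<in> {..<J}. fl j = n} \<le> K" for n
  proof -
    define a where "a = nat \<lceil>real n / \<alpha>\<rceil>"
    have "j \<in> {a..<a + K}" if "fl j = n" for j
    proof -
      have 1: "real n / \<alpha> \<le> real j" "real j < real n / \<alpha> + 1 / \<alpha>"
        using fl[of j] that assms by (auto simp: field_simps)
      have "real n / \<alpha> \<le> real a" "1 / \<alpha> \<le> real K"
        by (simp_all add: a_def K_def real_nat_ceiling_ge)
      moreover have "a \<le> j" using 1 unfolding a_def by (simp add: ceiling_le_iff nat_le_iff)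
      ultimately show ?thesis using 1 by auto
    qed
    then have "{j \<in> {..<J}. fl j = n} \<subseteq> {a..<a + K}" by auto
    from card_mono[OF _ this] show ?thesis by simp
  qed
  have "(\<Sum>j<J. (t powr \<alpha>) ^ j * ml_coeff \<alpha> j) \<le> (\<Sum>j<J. v (fl j))"
    by (intro sum_mono term_le)
  also have "\<dots> = (\<Sum>n\<in>fl ` {..<J}. \<Sum>j\<in>{j \<in> {..<J}. fl j = n}. v (fl j))"
    by (rule sum.image_gen) auto
  also have "\<dots> = (\<Sum>n\<in>fl ` {..<J}. real (card {j \<in> {..<J}. fl j = n}) * v n)"
    by (intro sum.cong) auto
  also have "\<dots> \<le> (\<Sum>n\<in>fl ` {..<J}. real K * v n)"
    using fibre v_nonneg by (intro sum_mono mult_right_mono) auto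
  also have "\<dots> = real K * (\<Sum>n\<in>fl ` {..<J}. v n)"
    by (simp add: sum_distrib_left)
  also have "\<dots> \<le> real K * (2 * t * exp t)"
  proof (intro mult_left_mono)
    have "v sums (2 * t * exp t)"
      unfolding v_def using exp_converges[of t] by (intro sums_mult) (simp add: field_simps)
    then show "(\<Sum>n\<in>fl ` {..<J}. v n) \<le> 2 * t * exp t"
      using v_nonneg sum_le_suminf[of v "fl ` {..<J}"] by (auto simp: sums_iff)
  qed auto
  finally show ?thesis by (simp add: K_def)
qed

lemma summable_ml_pos:
  assumes "\<alpha> > 0" "K \<ge> 0"
  shows "summable (\<lambda>j. K ^ j * ml_coeff \<alpha> j)"
proof -
  define t where "t = (max 1 K) powr (1 / \<alpha>)"
  have t: "t \<ge> 1" "t powr \<alpha> = max 1 K"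
    using assms by (auto simp: t_def powr_powr ge_one_powr_ge_zero)
  have "summable (\<lambda>j. (t powr \<alpha>) ^ j * ml_coeff \<alpha> j)"
  proof (rule bounded_imp_summable)
    show "(\<Sum>j\<le>n. (t powr \<alpha>) ^ j * ml_coeff \<alpha> j) \<le> real (nat \<lceil>1 / \<alpha>\<rceil>) * (2 * t * exp t)" for n
      using ml_partial_sum_le[OF assms(1) t(1), of "Suc n"] by (simp only: lessThan_Suc_atMost)
  qed (use ml_coeff_pos[OF assms(1)] in \<open>auto simp: less_imp_le\<close>)
  then show ?thesis
    by (rule summable_comparison_test')
      (use assms ml_coeff_pos[OF assms(1)] in
        \<open>auto simp: t abs_mult abs_of_pos intro!: mult_right_mono power_mono less_imp_le[of 0]\<close>)
qed

lemma summable_ml: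
  assumes "\<alpha> > 0"
  shows "summable (\<lambda>j. y ^ j * ml_coeff \<alpha> j)"
  by (rule summable_comparison_test'[OF summable_ml_pos[OF assms, of "\<bar>y\<bar>"]])
    (use ml_coeff_pos[OF assms] in \<open>auto simp: abs_mult power_abs less_imp_le\<close>)

lemma ml_le:
  assumes "\<alpha> > 0" "t \<ge> 1"
  shows "ml \<alpha> (t powr \<alpha>) \<le> real (nat \<lceil>1 / \<alpha>\<rceil>) * (2 * t * exp t)"
  unfolding ml_def by (intro suminf_le_const summable_ml assms ml_partial_sum_le)

text \<open>
  Since \<open>\<alpha> \<le> 1\<close>, the multiples of \<open>\<alpha>\<close> meet each interval from \<open>n\<close> to \<open>n + 1\<close>. Keeping one term
  for each \<open>n\<close> leaves the exponential series with \<open>n!\<close> replaced by \<open>(n + 2)!\<close>.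
\<close>

lemma ml_ge:
  assumes "0 < \<alpha>" "\<alpha> \<le> 1" "t \<ge> 1"
  shows "(exp t - 1 - t) / t\<^sup>2 \<le> ml \<alpha> (t powr \<alpha>)"
proof -
  define J where "J n = nat \<lceil>real n / \<alpha>\<rceil>" for n
  have J: "real n \<le> \<alpha> * real (J n)" "\<alpha> * real (J n) < real n + 1" for n
  proof -
    have nn: "real n / \<alpha> \<ge> 0" using assms by simp
    have a: "real n / \<alpha> \<le> real (J n)" "real (J n) < real n / \<alpha> + 1"
      using nn unfolding J_def by linarith+
    show "real n \<le> \<alpha> * real (J n)" using a(1) assms by (simp add: field_simps)
    have "\<alpha> * real (J n) < real n + \<alpha>" using a(2) assms by (simp add: field_simps)
    then show "\<alpha> * real (J n) < real n + 1" using assms by linarith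
  qed
  have inj: "inj J"
  proof (rule injI)
    fix m n assume "J m = J n"
    then have "real m < real n + 1" "real n < real m + 1" using J[of m] J[of n] by auto
    then show "m = n" by linarith
  qed
  have term_ge: "t ^ n / fact (n + 2) \<le> (t powr \<alpha>) ^ J n * ml_coeff \<alpha> (J n)" for n
  proof -
    have "t ^ n = t powr real n" using assms by (simp add: powr_realpow)
    also have "\<dots> \<le> t powr (\<alpha> * real (J n))"
      using assms J(1)[of n] by (intro powr_mono) auto
    also have "\<dots> = (t powr \<alpha>) ^ J n"
      using assms by (simp add: powr_realpow [symmetric] powr_powr)
    finally have 1: "t ^ n \<le> (t powr \<alpha>) ^ J n" .
    have "0 < Gamma (1 + \<alpha> * real (J n))"
      using assms by (intro Gamma_real_pos add_pos_nonneg) auto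
    then have "1 / fact (n + 2) \<le> ml_coeff \<alpha> (J n)"
      unfolding ml_coeff_def using J[of n] Gamma_floor_bounds(2)[of n "\<alpha> * real (J n)"]
      by (intro divide_left_mono mult_pos_pos) auto
    with 1 assms have "t ^ n * (1 / fact (n + 2)) \<le> (t powr \<alpha>) ^ J n * ml_coeff \<alpha> (J n)"
      by (intro mult_mono) auto
    then show ?thesis by simp
  qed
  have "(\<lambda>n. t ^ (n + 2) / fact (n + 2)) sums (exp t - (\<Sum>n<2. t ^ n / fact n))"
    using exp_converges[of t] by (intro sums_split_initial_segment) (simp add: field_simps)
  then have "(\<lambda>n. t ^ (n + 2) / fact (n + 2) / t\<^sup>2) sums ((exp t - 1 - t) / t\<^sup>2)"
    by (intro sums_divide) (simp add: eval_nat_numeral diff_diff_eq)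
  moreover have "t ^ (n + 2) / fact (n + 2) / t\<^sup>2 = t ^ n / fact (n + 2)" for n
    using assms by (simp add: power_add power2_eq_square del: fact_Suc)
  ultimately have s: "(\<lambda>n. t ^ n / fact (n + 2)) sums ((exp t - 1 - t) / t\<^sup>2)"
    by (simp del: fact_Suc)
  have "(\<Sum>n<N. t ^ n / fact (n + 2)) \<le> ml \<alpha> (t powr \<alpha>)" for N
  proof -
    have "(\<Sum>n<N. t ^ n / fact (n + 2)) \<le> (\<Sum>n<N. (t powr \<alpha>) ^ J n * ml_coeff \<alpha> (J n))"
      by (intro sum_mono term_ge)
    also have "\<dots> = (\<Sum>j\<in>J ` {..<N}. (t powr \<alpha>) ^ j * ml_coeff \<alpha> j)"
      using inj by (subst sum.reindex) (auto intro: inj_on_subset)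
    also have "\<dots> \<le> ml \<alpha> (t powr \<alpha>)"
      unfolding ml_def using assms ml_coeff_pos[of \<alpha>]
      by (intro sum_le_suminf summable_ml) (auto simp: less_imp_le)
    finally show ?thesis .
  qed
  then show ?thesis using s by (metis sums_iff suminf_le_const)
qed

section \<open>Positivity of the fractional Poisson probabilities\<close>

text \<open>
  The coefficient of \<open>y ^ m\<close> in \<open>(1 - y) powr (- z)\<close>.
\<close>

definition nb_coeff :: "real \<Rightarrow> nat \<Rightarrow> real" where
  "nb_coeff z m = pochhammer z m / fact m"

lemma nb_coeff_0 [simp]: "nb_coeff z 0 = 1"
  by (simp add: nb_coeff_def)

lemma nb_coeff_Suc: "nb_coeff (z + 1) (Suc m) = nb_coeff (z + 1) m * (1 + z / real (Suc m))"
proof -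
  have "z + 1 + real m = real (Suc m) * (1 + z / real (Suc m))"
    by (simp add: field_simps)
  then show ?thesis
    unfolding nb_coeff_def pochhammer_Suc fact_Suc of_nat_mult by (simp add: mult_ac del: of_nat_Suc)
qed

lemma nb_coeff_nonneg: "z \<ge> 0 \<Longrightarrow> nb_coeff z m \<ge> 0"
  by (auto simp: nb_coeff_def pochhammer_prod intro!: divide_nonneg_pos prod_nonneg)

lemma nb_coeff_Vandermonde: "(\<Sum>l\<le>m. nb_coeff a l * nb_coeff b (m - l)) = nb_coeff (a + b) m"
proof -
  have "nb_coeff a l * nb_coeff b (m - l) =
      (of_nat (m choose l) * pochhammer a l * pochhammer b (m - l)) / fact m" if "l \<le> m" for l
    using that by (simp add: nb_coeff_def binomial_fact field_simps)
  then show ?thesis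
    by (simp add: nb_coeff_def pochhammer_binomial_sum sum_divide_distrib)
qed

lemma nb_coeff_le_power:
  assumes "z \<ge> 0"
  shows "nb_coeff (z + 1) m \<le> (1 + z) ^ m"
proof (induction m)
  case (Suc m)
  have "z / real (Suc m) \<le> z / 1" using assms by (intro divide_left_mono) auto
  then show ?case
    using Suc assms by (auto simp: nb_coeff_Suc mult.commute[of "1 + z"] simp del: of_nat_Suc
        intro!: mult_mono)
qed simp

text \<open>
  The product \<open>\<Prod>l\<le>m. (1 + z / l)\<close> is estimated crudely up to \<open>L\<close> and by \<open>1 + v \<le> exp v\<close> from there
  on. The free parameter \<open>L\<close> produces a factor \<open>L powr (- z)\<close>, which makes the series of
  \<open>fpp_pmf_nonneg\<close> converge for all arguments, not only for small ones.
\<close>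

lemma nb_coeff_le:
  assumes z: "z \<ge> 0" and L: "1 \<le> L" and Lm: "L \<le> m"
  shows "nb_coeff (z + 1) m \<le> (1 + z) ^ L * (real m / real L) powr z"
  using Lm
proof (induction m rule: dec_induct)
  case base
  then show ?case using nb_coeff_le_power[OF z] L by simp
next
  case (step m)
  have m: "real m > 0" using step L by simp
  have "ln (real m / real (Suc m)) \<le> real m / real (Suc m) - 1"
    using m by (intro ln_le_minus_one) auto
  also have "\<dots> = - (1 / real (Suc m))" by (simp add: field_simps)
  finally have "1 / real (Suc m) \<le> ln (real (Suc m) / real m)"
    using m by (simp add: ln_div)
  then have "z * (1 / real (Suc m)) \<le> z * ln (real (Suc m) / real m)"
    using z by (intro mult_left_mono)
  then have "exp (z / real (Suc m)) \<le> (real (Suc m) / real m) powr z"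
    using m by (simp add: powr_def del: of_nat_Suc)
  then have "1 + z / real (Suc m) \<le> (real (Suc m) / real m) powr z"
    using exp_ge_add_one_self[of "z / real (Suc m)"] by linarith
  then have "nb_coeff (z + 1) (Suc m) \<le>
      ((1 + z) ^ L * (real m / real L) powr z) * (real (Suc m) / real m) powr z"
    unfolding nb_coeff_Suc using step.IH z by (intro mult_mono) auto
  also have "\<dots> = (1 + z) ^ L * (real (Suc m) / real L) powr z"
    using m L by (simp add: powr_mult [symmetric] mult.assoc del: of_nat_Suc)
  finally show ?case .
qed

text \<open>
  Gauss's product for Gamma, in the form in which it links the discretisation below to the
  Mittag-Leffler coefficients.
\<close>

lemma nb_coeff_tendsto: "(\<lambda>m. nb_coeff (z + 1) m * real m powr (- z)) \<longlonglongrightarrow> 1 / Gamma (1 + z)" if "z \<ge> 0"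
proof -
  have nz: "Gamma (z + 1) \<noteq> 0"
    using Gamma_real_pos[of "z + 1"] that by linarith
  have "(\<lambda>m. inverse (Gamma_series' (z + 1) m)) \<longlonglongrightarrow> inverse (Gamma (z + 1))"
    by (intro tendsto_inverse Gamma_series'_LIMSEQ nz)
  moreover have "\<forall>\<^sub>F m in sequentially.
      inverse (Gamma_series' (z + 1) m) = nb_coeff (z + 1) m * real m powr (- z)"
    using eventually_gt_at_top[of 0]
  proof eventually_elim
    case (elim m)
    have "fact m = real m * fact (m - 1)" using elim by (simp add: fact_reduce)
    then show ?case using elim
      by (simp add: Gamma_series'_def nb_coeff_def powr_def exp_minus field_simps exp_add)
  qed
  ultimately show ?thesis
    by (simp add: tendsto_cong inverse_eq_divide add.commute)
qed

lemma summable_poly_geometric: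
  assumes "0 < c" "c < (1::real)"
  shows "summable (\<lambda>i. (1 + real i) ^ N * c ^ i)"
proof (rule summable_comparison_test_bigo)
  define d where "d = (1 + c) / 2"
  have d: "0 < d" "d < 1" "c < d" using assms by (auto simp: d_def)
  show "summable (\<lambda>i. norm (d ^ i))" using d by (simp add: summable_geometric)
  show "(\<lambda>i. (1 + real i) ^ N * c ^ i) \<in> O(\<lambda>i. d ^ i)"
    using assms d by real_asymp
qed

text \<open>
  A Grunwald-Letnikov discretisation of the fractional Poisson process, where \<open>m\<close> counts time steps
  and \<open>c\<close> is \<open>lam\<close> times the \<open>\<alpha>\<close>-th power of the step length: the coefficient of \<open>z ^ k * y ^ m\<close> in
  \<open>(1 - y) powr (\<alpha> - 1) / ((1 - y) powr \<alpha> - c * (z - 1))\<close>, expanded in powers of \<open>c\<close>.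
\<close>

definition discrete_pmf :: "real \<Rightarrow> real \<Rightarrow> nat \<Rightarrow> nat \<Rightarrow> real" where
  "discrete_pmf \<alpha> c k m = (\<Sum>i. real (i choose k) * (- 1) ^ (i + k) * c ^ i * nb_coeff (\<alpha> * real i + 1) m)"

lemma binomial_le_Suc_power: "real (i choose k) \<le> (1 + real i) ^ k"
proof -
  have "i choose k \<le> i ^ k"
    by (cases "k \<le> i") (auto intro: binomial_le_pow simp: binomial_eq_0)
  then have "real (i choose k) \<le> real i ^ k" by (metis of_nat_le_iff of_nat_power)
  also have "\<dots> \<le> (1 + real i) ^ k" by (intro power_mono) auto
  finally show ?thesis .
qed

context
  fixes \<alpha> c :: real
  assumes \<alpha>: "0 < \<alpha>" "\<alpha> \<le> 1" and c: "0 < c" "c < 1"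
begin



lemma summable_discrete_pmf:
  "summable (\<lambda>i. real (i choose k) * (- 1) ^ (i + k) * c ^ i * nb_coeff (\<alpha> * real i + 1) m)"
proof (rule summable_comparison_test'[OF summable_poly_geometric[OF c, of "k + m"]])
  fix i :: nat
  have "nb_coeff (\<alpha> * real i + 1) m \<le> (1 + \<alpha> * real i) ^ m"
    using \<alpha> by (intro nb_coeff_le_power) auto
  also have "\<dots> \<le> (1 + real i) ^ m"
    using \<alpha> by (intro power_mono) (auto intro: mult_left_le_one_le)
  finally have "real (i choose k) * nb_coeff (\<alpha> * real i + 1) m * c ^ i
      \<le> (1 + real i) ^ k * (1 + real i) ^ m * c ^ i"
    using \<alpha> c binomial_le_Suc_power[of i k]
    by (intro mult_right_mono mult_mono nb_coeff_nonneg) auto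
  then show "norm (real (i choose k) * (- 1) ^ (i + k) * c ^ i * nb_coeff (\<alpha> * real i + 1) m)
      \<le> (1 + real i) ^ (k + m) * c ^ i"
    using \<alpha> c nb_coeff_nonneg[of "\<alpha> * real i + 1" m] by (simp add: abs_mult power_add mult_ac)
qed

text \<open>
  Multiply the generating function by its denominator and compare coefficients. Earlier values
  enter the right-hand side with nonnegative factors, because the coefficients of
  \<open>(1 - y) powr \<alpha>\<close> beyond the constant one are nonpositive for \<open>\<alpha> \<le> 1\<close>. So nonnegativity follows
  by induction.
\<close>

lemma discrete_pmf_recurrence:
  "(1 + c) * discrete_pmf \<alpha> c k m =
     (\<Sum>l\<in>{1..m}. - nb_coeff (- \<alpha>) l * discrete_pmf \<alpha> c k (m - l)) +
     (case k of 0 \<Rightarrow> nb_coeff (1 - \<alpha>) m | Suc k' \<Rightarrow> c * discrete_pmf \<alpha> c k' m)"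
proof -
  define u where "u k i = real (i choose k) * (- 1) ^ (i + k) * c ^ i" for k i
  have W: "(\<lambda>i. u k i * nb_coeff (\<alpha> * real i + 1) m) sums discrete_pmf \<alpha> c k m" for k m
    using summable_discrete_pmf[of k m] by (simp add: discrete_pmf_def u_def summable_sums)
  have u_Suc: "u k (Suc i) = (case k of 0 \<Rightarrow> 0 | Suc k' \<Rightarrow> c * u k' i) - c * u k i" for i
    by (cases k) (simp_all add: u_def algebra_simps)
  have u_0: "u k 0 = (if k = 0 then 1 else 0)"
    by (simp add: u_def)
  have "(\<lambda>i. \<Sum>l\<le>m. nb_coeff (- \<alpha>) l * (u k i * nb_coeff (\<alpha> * real i + 1) (m - l))) sums
      (\<Sum>l\<le>m. nb_coeff (- \<alpha>) l * discrete_pmf \<alpha> c k (m - l))"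
    by (intro sums_sum sums_mult W)
  also have "(\<lambda>i. \<Sum>l\<le>m. nb_coeff (- \<alpha>) l * (u k i * nb_coeff (\<alpha> * real i + 1) (m - l))) =
      (\<lambda>i. u k i * nb_coeff (\<alpha> * real i + 1 - \<alpha>) m)"
  proof
    fix i
    have "(\<Sum>l\<le>m. nb_coeff (- \<alpha>) l * (u k i * nb_coeff (\<alpha> * real i + 1) (m - l))) =
        u k i * (\<Sum>l\<le>m. nb_coeff (- \<alpha>) l * nb_coeff (\<alpha> * real i + 1) (m - l))"
      by (simp add: sum_distrib_left mult_ac)
    then show "(\<Sum>l\<le>m. nb_coeff (- \<alpha>) l * (u k i * nb_coeff (\<alpha> * real i + 1) (m - l))) =
        u k i * nb_coeff (\<alpha> * real i + 1 - \<alpha>) m"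
      by (simp add: nb_coeff_Vandermonde)
  qed
  finally have 1: "(\<lambda>i. u k i * nb_coeff (\<alpha> * real i + 1 - \<alpha>) m) sums
      (\<Sum>l\<le>m. nb_coeff (- \<alpha>) l * discrete_pmf \<alpha> c k (m - l))" .
  have "(\<lambda>i. (case k of 0 \<Rightarrow> 0 | Suc k' \<Rightarrow> c * (u k' i * nb_coeff (\<alpha> * real i + 1) m)) -
      c * (u k i * nb_coeff (\<alpha> * real i + 1) m)) sums
      ((case k of 0 \<Rightarrow> 0 | Suc k' \<Rightarrow> c * discrete_pmf \<alpha> c k' m) - c * discrete_pmf \<alpha> c k m)"
    using W by (cases k) (auto intro!: sums_diff sums_mult sums_zero sums_minus)
  also have "(\<lambda>i. (case k of 0 \<Rightarrow> 0 | Suc k' \<Rightarrow> c * (u k' i * nb_coeff (\<alpha> * real i + 1) m)) -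
      c * (u k i * nb_coeff (\<alpha> * real i + 1) m)) =
      (\<lambda>i. u k (Suc i) * nb_coeff (\<alpha> * real (Suc i) + 1 - \<alpha>) m)"
    by (intro ext, subst u_Suc) (auto simp: algebra_simps split: nat.split)
  finally have "(\<lambda>i. u k i * nb_coeff (\<alpha> * real i + 1 - \<alpha>) m) sums
      ((case k of 0 \<Rightarrow> 0 | Suc k' \<Rightarrow> c * discrete_pmf \<alpha> c k' m) - c * discrete_pmf \<alpha> c k m + u k 0 * nb_coeff (1 - \<alpha>) m)"
    by (subst (asm) sums_Suc_iff) simp
  with 1 have "(\<Sum>l\<le>m. nb_coeff (- \<alpha>) l * discrete_pmf \<alpha> c k (m - l)) =
      (case k of 0 \<Rightarrow> 0 | Suc k' \<Rightarrow> c * discrete_pmf \<alpha> c k' m) - c * discrete_pmf \<alpha> c k m + u k 0 * nb_coeff (1 - \<alpha>) m"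
    by (rule sums_unique2)
  moreover have "(\<Sum>l\<le>m. nb_coeff (- \<alpha>) l * discrete_pmf \<alpha> c k (m - l)) =
      discrete_pmf \<alpha> c k m + (\<Sum>l\<in>{1..m}. nb_coeff (- \<alpha>) l * discrete_pmf \<alpha> c k (m - l))"
    by (simp add: atMost_atLeast0 sum.atLeast_Suc_atMost)
  ultimately show ?thesis
    by (auto simp: u_0 sum_negf algebra_simps split: nat.splits)
qed

lemma nb_coeff_uminus_nonpos: "l \<ge> 1 \<Longrightarrow> nb_coeff (- \<alpha>) l \<le> 0"
proof -
  assume "l \<ge> 1"
  then obtain l' where l: "l = Suc l'" by (cases l) auto
  have "pochhammer (1 - \<alpha>) l' \<ge> 0"
    using \<alpha> by (auto simp: pochhammer_prod intro!: prod_nonneg)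
  then show ?thesis
    using \<alpha> by (auto simp: nb_coeff_def l pochhammer_rec divide_le_0_iff intro: mult_nonneg_nonneg)
qed

lemma discrete_pmf_nonneg: "discrete_pmf \<alpha> c k m \<ge> 0"
proof (induction k arbitrary: m)
  case 0
  show ?case
  proof (induction m rule: less_induct)
    case (less m)
    have "(\<Sum>l\<in>{1..m}. - nb_coeff (- \<alpha>) l * discrete_pmf \<alpha> c 0 (m - l)) \<ge> 0"
      using less nb_coeff_uminus_nonpos by (intro sum_nonneg mult_nonneg_nonneg) auto
    then have "(1 + c) * discrete_pmf \<alpha> c 0 m \<ge> 0"
      using \<alpha> nb_coeff_nonneg[of "1 - \<alpha>" m] by (subst discrete_pmf_recurrence) simp
    then show ?case using c by (simp add: zero_le_mult_iff)
  qed
next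
  case (Suc k)
  show ?case
  proof (induction m rule: less_induct)
    case (less m)
    have "(\<Sum>l\<in>{1..m}. - nb_coeff (- \<alpha>) l * discrete_pmf \<alpha> c (Suc k) (m - l)) \<ge> 0"
      using less nb_coeff_uminus_nonpos by (intro sum_nonneg mult_nonneg_nonneg) auto
    then have "(1 + c) * discrete_pmf \<alpha> c (Suc k) m \<ge> 0"
      using c Suc by (subst discrete_pmf_recurrence) auto
    then show ?case using c by (simp add: zero_le_mult_iff)
  qed
qed

end

text \<open>
  For \<open>x = lam * t powr \<alpha>\<close>, the probability that the fractional Poisson process with rate \<open>lam\<close> has
  \<open>k\<close> events up to time \<open>t\<close>; equivalently \<open>x ^ k / k!\<close> times the \<open>k\<close>-th derivative of \<open>ml \<alpha>\<close> at \<open>- x\<close>.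
\<close>

definition fpp_pmf :: "real \<Rightarrow> nat \<Rightarrow> real \<Rightarrow> real" where
  "fpp_pmf \<alpha> k x = (\<Sum>i. real (i choose k) * (- 1) ^ (i + k) * x ^ i * ml_coeff \<alpha> i)"

text \<open>
  With \<open>c = x * m powr (- \<alpha>)\<close> the nonnegative discrete probabilities converge to \<open>fpp_pmf \<alpha> k x\<close> as
  \<open>m\<close> tends to infinity: term by term this is Gauss's product, and Tannery's theorem allows passing
  to the limit under the sum.
\<close>

lemma fpp_pmf_nonneg:
  assumes \<alpha>: "0 < \<alpha>" "\<alpha> \<le> 1" and x: "x > 0"
  shows "fpp_pmf \<alpha> k x \<ge> 0"
proof -
  define a where "a i m = real (i choose k) * (- 1) ^ (i + k) * (x * real m powr (- \<alpha>)) ^ i *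
    nb_coeff (\<alpha> * real i + 1) m" for i m
  have powr_pow: "(x * real m powr (- \<alpha>)) ^ i = x ^ i * real m powr (- (\<alpha> * real i))" if "m > 0" for i m
    using that by (simp add: power_mult_distrib powr_realpow [symmetric] powr_powr)
  \<comment> \<open>\<open>L\<close> is fixed so large that the dominating series below is geometric up to polynomial factors.\<close>
  have "\<forall>\<^sub>F m in sequentially. x * real m powr (- \<alpha>) < 1 / 2"
    using \<alpha> x by real_asymp
  then obtain L where L: "L \<ge> 1" "x * real L powr (- \<alpha>) < 1 / 2"
    unfolding eventually_sequentially by (metis max.cobounded1 max.cobounded2)
  define d where "d = x * real L powr (- \<alpha>)"
  have d: "0 < d" "d < 1" using L x by (auto simp: d_def)
  have lim: "(\<lambda>m. a i m) \<longlonglongrightarrow> real (i choose k) * (- 1) ^ (i + k) * x ^ i * ml_coeff \<alpha> i" for i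
  proof -
    have "(\<lambda>m. (real (i choose k) * (- 1) ^ (i + k) * x ^ i) *
        (nb_coeff (\<alpha> * real i + 1) m * real m powr (- (\<alpha> * real i)))) \<longlonglongrightarrow>
        (real (i choose k) * (- 1) ^ (i + k) * x ^ i) * (1 / Gamma (1 + \<alpha> * real i))"
      using \<alpha> by (intro tendsto_mult_left nb_coeff_tendsto) auto
    moreover have "\<forall>\<^sub>F m in sequentially. (real (i choose k) * (- 1) ^ (i + k) * x ^ i) *
        (nb_coeff (\<alpha> * real i + 1) m * real m powr (- (\<alpha> * real i))) = a i m"
      using eventually_gt_at_top[of 0] by eventually_elim (simp add: a_def powr_pow)
    ultimately show ?thesis
      by (simp add: tendsto_cong ml_coeff_def)
  qed
  have bound: "norm (a i m) \<le> (1 + real i) ^ (k + L) * d ^ i" if "m \<ge> L" for i m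
  proof -
    have m: "real m > 0" using that L by simp
    have "nb_coeff (\<alpha> * real i + 1) m \<le> (1 + \<alpha> * real i) ^ L * (real m / real L) powr (\<alpha> * real i)"
      using \<alpha> L that by (intro nb_coeff_le) auto
    also have "\<dots> \<le> (1 + real i) ^ L * (real m / real L) powr (\<alpha> * real i)"
      using \<alpha> by (intro mult_right_mono power_mono) (auto intro: mult_left_le_one_le)
    finally have "real m powr (- (\<alpha> * real i)) * nb_coeff (\<alpha> * real i + 1) m \<le>
        real m powr (- (\<alpha> * real i)) * ((1 + real i) ^ L * (real m / real L) powr (\<alpha> * real i))"
      by (intro mult_left_mono) auto
    also have "\<dots> = (1 + real i) ^ L * real L powr (- (\<alpha> * real i))"
      using m L by (simp add: powr_divide powr_minus field_simps)
    finally have 1: "real m powr (- (\<alpha> * real i)) * nb_coeff (\<alpha> * real i + 1) m \<le>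
        (1 + real i) ^ L * real L powr (- (\<alpha> * real i))" .
    have "norm (a i m) =
        real (i choose k) * x ^ i * (real m powr (- (\<alpha> * real i)) * nb_coeff (\<alpha> * real i + 1) m)"
      using m x \<alpha> nb_coeff_nonneg[of "\<alpha> * real i + 1" m]
      by (simp add: a_def abs_mult powr_pow)
    also have "\<dots> \<le> (1 + real i) ^ k * x ^ i * ((1 + real i) ^ L * real L powr (- (\<alpha> * real i)))"
      using \<alpha> x binomial_le_Suc_power[of i k]
      by (intro mult_mono[OF mult_right_mono 1] mult_nonneg_nonneg nb_coeff_nonneg) auto
    also have "\<dots> = (1 + real i) ^ (k + L) * d ^ i"
      using L by (simp add: d_def powr_pow power_add)
    finally show ?thesis .
  qed
  have "(\<lambda>m. \<Sum>i. a i m) \<longlonglongrightarrow> fpp_pmf \<alpha> k x"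
    unfolding fpp_pmf_def
  proof (intro conjunct2[OF conjunct2[OF tannerys_theorem]] lim)
    show "\<forall>\<^sub>F (i, m) in at_top \<times>\<^sub>F sequentially. norm (a i m) \<le> (1 + real i) ^ (k + L) * d ^ i"
      unfolding eventually_prod_filter
      by (intro exI[of _ "\<lambda>_. True"] exI[of _ "\<lambda>m. m \<ge> L"])
        (use bound in \<open>auto simp: eventually_ge_at_top\<close>)
  qed (use summable_poly_geometric[OF d] in auto)
  moreover have "\<forall>\<^sub>F m in sequentially. (\<Sum>i. a i m) \<ge> 0"
  proof -
    have "\<forall>\<^sub>F m in sequentially. x * real m powr (- \<alpha>) < 1"
      using \<alpha> x by real_asymp
    then show ?thesis
      using eventually_gt_at_top[of 0]
    proof eventually_elim
      case (elim m)
      then have "discrete_pmf \<alpha> (x * real m powr (- \<alpha>)) k m \<ge> 0"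
        using \<alpha> x by (intro discrete_pmf_nonneg) auto
      then show ?case by (simp add: discrete_pmf_def a_def)
    qed
  qed
  ultimately show ?thesis
    by (rule tendsto_lowerbound) auto
qed

section \<open>Generating function of the fractional Poisson law\<close>

lemma summable_norm_fpp_pmf:
  assumes "\<alpha> > 0"
  shows "summable (\<lambda>i. norm (real (i choose k) * (- 1) ^ (i + k) * x ^ i * ml_coeff \<alpha> i))"
proof (rule summable_comparison_test')
  show "summable (\<lambda>i. (2 * \<bar>x\<bar>) ^ i * ml_coeff \<alpha> i)"
    using assms by (intro summable_ml_pos) auto
  fix i
  have "real (i choose k) \<le> 2 ^ i"
    using binomial_le_pow2[of i k] by (metis of_nat_le_iff of_nat_numeral of_nat_power)
  then show "norm (norm (real (i choose k) * (- 1) ^ (i + k) * x ^ i * ml_coeff \<alpha> i)) \<le> (2 * \<bar>x\<bar>) ^ i * ml_coeff \<alpha> i"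
    using ml_coeff_pos[OF assms, of i]
    by (auto simp: abs_mult power_abs power_mult_distrib intro!: mult_right_mono)
qed

text \<open>
  Expand \<open>(x * (z - 1)) ^ i\<close> by the binomial theorem and interchange the two sums; absolute
  convergence holds because the moduli add up to \<open>ml \<alpha> (\<bar>x\<bar> * (\<bar>z\<bar> + 1))\<close>.
\<close>

lemma fpp_pmf_sums:
  assumes \<alpha>: "\<alpha> > 0"
  shows "(\<lambda>k. fpp_pmf \<alpha> k x * z ^ k) sums ml \<alpha> (x * (z - 1))"
proof -
  define f where "f i k = real (i choose k) * (- 1) ^ (i + k) * x ^ i * ml_coeff \<alpha> i * z ^ k" for i k
  have inner: "(g has_sum (\<Sum>k\<le>i. g k)) UNIV" if "\<And>k. k > i \<Longrightarrow> g k = 0" for g :: "nat \<Rightarrow> real" and i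
  proof -
    have "(g has_sum (\<Sum>k\<le>i. g k)) {..i} \<longleftrightarrow> (g has_sum (\<Sum>k\<le>i. g k)) UNIV"
      by (rule has_sum_cong_neutral) (use that in auto)
    then show ?thesis by (simp add: has_sum_finite)
  qed
  have abs_i: "((\<lambda>k. norm (f i k)) has_sum (\<bar>x\<bar> * (\<bar>z\<bar> + 1)) ^ i * ml_coeff \<alpha> i) UNIV" for i
  proof -
    have "(\<Sum>k\<le>i. norm (f i k)) = \<bar>x\<bar> ^ i * ml_coeff \<alpha> i * (\<Sum>k\<le>i. real (i choose k) * \<bar>z\<bar> ^ k * 1 ^ (i - k))"
      using ml_coeff_pos[OF \<alpha>, of i] by (simp add: f_def abs_mult power_abs sum_distrib_left mult_ac)
    also have "\<dots> = (\<bar>x\<bar> * (\<bar>z\<bar> + 1)) ^ i * ml_coeff \<alpha> i"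
      by (subst binomial_ring [symmetric]) (simp add: power_mult_distrib mult_ac)
    finally show ?thesis
      using inner[of i "\<lambda>k. norm (f i k)"] by (simp add: f_def)
  qed
  have sum_i: "((\<lambda>k. f i k) has_sum (x * (z - 1)) ^ i * ml_coeff \<alpha> i) UNIV" for i
  proof -
    have "(\<Sum>k\<le>i. f i k) = x ^ i * ml_coeff \<alpha> i * (\<Sum>k\<le>i. real (i choose k) * z ^ k * (- 1) ^ (i - k))"
      by (auto simp: f_def sum_distrib_left mult_ac uminus_power_if intro!: sum.cong)
    also have "\<dots> = (x * (z - 1)) ^ i * ml_coeff \<alpha> i"
      by (subst binomial_ring [symmetric]) (simp add: power_mult_distrib mult_ac)
    finally show ?thesis
      using inner[of i "\<lambda>k. f i k"] by (simp add: f_def)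
  qed
  have "(\<lambda>p. norm (case p of (i, k) \<Rightarrow> f i k)) summable_on UNIV \<times> UNIV"
    unfolding Infinite_Sum.abs_summable_on_Sigma_iff
  proof (intro conjI ballI)
    show "(\<lambda>k. norm (case (i, k) of (i, k) \<Rightarrow> f i k)) summable_on UNIV" for i
      using abs_i[of i] by (auto simp: summable_on_def)
    have "(\<lambda>i. norm ((\<bar>x\<bar> * (\<bar>z\<bar> + 1)) ^ i * ml_coeff \<alpha> i)) summable_on UNIV"
      using summable_ml_pos[OF \<alpha>, of "\<bar>x\<bar> * (\<bar>z\<bar> + 1)"] ml_coeff_pos[OF \<alpha>]
      by (intro norm_summable_imp_summable_on) (simp add: abs_mult abs_of_pos)
    moreover have "infsum (\<lambda>k. norm (f i k)) UNIV = (\<bar>x\<bar> * (\<bar>z\<bar> + 1)) ^ i * ml_coeff \<alpha> i" for i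
      using abs_i[of i] by (rule infsumI)
    ultimately show "(\<lambda>i. norm (infsum (\<lambda>k. norm (case (i, k) of (i, k) \<Rightarrow> f i k)) UNIV)) summable_on UNIV"
      by simp
  qed
  then have sm: "(\<lambda>(i, k). f i k) summable_on UNIV \<times> UNIV"
    by (rule abs_summable_summable)
  then obtain S where S: "((\<lambda>(i, k). f i k) has_sum S) (UNIV \<times> UNIV)"
    by (auto simp: summable_on_def)
  have "((\<lambda>i. (x * (z - 1)) ^ i * ml_coeff \<alpha> i) has_sum S) UNIV"
    by (rule has_sum_SigmaD[OF S]) (use sum_i in auto)
  then have S_eq: "S = ml \<alpha> (x * (z - 1))"
    unfolding ml_def by (intro sums_unique has_sum_imp_sums)
  have sum_k: "((\<lambda>i. f i k) has_sum fpp_pmf \<alpha> k x * z ^ k) UNIV" for k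
  proof -
    define a where "a i = real (i choose k) * (- 1) ^ (i + k) * x ^ i * ml_coeff \<alpha> i" for i
    have "summable (\<lambda>i. norm (a i))"
      unfolding a_def by (rule summable_norm_fpp_pmf[OF \<alpha>])
    then have "(a has_sum suminf a) UNIV"
      using norm_summable_imp_has_sum[OF _ summable_sums[OF summable_norm_cancel]] by blast
    also have "suminf a = fpp_pmf \<alpha> k x"
      by (simp add: fpp_pmf_def a_def[abs_def])
    finally have "(a has_sum fpp_pmf \<alpha> k x) UNIV" .
    then show ?thesis
      unfolding f_def a_def by (rule has_sum_cmult_left)
  qed
  have "((\<lambda>(k, i). f i k) has_sum S) (UNIV \<times> UNIV)"
    using S by (subst has_sum_swap) simp
  then have "((\<lambda>k. fpp_pmf \<alpha> k x * z ^ k) has_sum S) UNIV"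
    by (rule has_sum_SigmaD) (use sum_k in auto)
  then show ?thesis
    unfolding S_eq by (rule has_sum_imp_sums)
qed

lemma ml_0 [simp]: "ml \<alpha> 0 = 1"
  using powser_zero[of "ml_coeff \<alpha>"] by (simp add: ml_def ml_coeff_def mult.commute)

lemma fpp_pmf_0: "fpp_pmf \<alpha> 0 x = ml \<alpha> (- x)"
  by (simp add: fpp_pmf_def ml_def power_mult_distrib [symmetric])

text \<open>
  The function \<open>ml \<alpha>\<close> is nonnegative and nondecreasing on the negative half-line, by re-expanding it
  with nonnegative coefficients at points further to the left. A zero would therefore force it to
  vanish on a whole half-line, contradicting that zeros of a nonconstant power series are isolated.
\<close>

lemma ml_neg_pos:
  assumes \<alpha>: "0 < \<alpha>" "\<alpha> \<le> 1" and x: "x > 0"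
  shows "ml \<alpha> (- x) > 0"
proof (rule ccontr)
  assume "\<not> ml \<alpha> (- x) > 0"
  with fpp_pmf_nonneg[OF \<alpha> x, of 0] have zero: "ml \<alpha> (- x) = 0"
    by (simp add: fpp_pmf_0)
  have beyond: "ml \<alpha> (- y) = 0" if "y \<ge> x" for y
  proof -
    have y: "y > 0" using that x by simp
    define z where "z = 1 - x / y"
    have z: "z \<ge> 0" "y * (z - 1) = - x" using that y x by (auto simp: z_def field_simps)
    have "(\<lambda>k. fpp_pmf \<alpha> k y * 0 ^ k) sums ml \<alpha> (- y)"
      using fpp_pmf_sums[OF \<alpha>(1), of y 0] by simp
    moreover have "(\<lambda>k. fpp_pmf \<alpha> k y * z ^ k) sums ml \<alpha> (- x)"
      using fpp_pmf_sums[OF \<alpha>(1), of y z] z by simp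
    ultimately have "ml \<alpha> (- y) \<le> ml \<alpha> (- x)"
      using fpp_pmf_nonneg[OF \<alpha> y] z by (elim sums_le[rotated]) (auto intro!: mult_left_mono power_mono)
    then show ?thesis
      using fpp_pmf_nonneg[OF \<alpha> y, of 0] zero by (simp add: fpp_pmf_0)
  qed
  have "\<exists>m>0. fpp_pmf \<alpha> m x \<noteq> 0"
  proof (rule ccontr)
    assume "\<not> (\<exists>m>0. fpp_pmf \<alpha> m x \<noteq> 0)"
    then have "fpp_pmf \<alpha> m x = 0" for m
      using zero by (cases m) (auto simp: fpp_pmf_0)
    then show False
      using fpp_pmf_sums[OF \<alpha>(1), of x 1] by (auto simp: sums_iff)
  qed
  then obtain m where m: "m > 0" "fpp_pmf \<alpha> m x \<noteq> 0" by auto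
  obtain s where s: "s > 0" "\<And>z. z \<in> cball 0 s - {0} \<Longrightarrow> ml \<alpha> (x * (z - 1)) \<noteq> 0"
    by (rule powser_0_nonzero[where r = 1 and \<xi> = 0 and a = "\<lambda>k. fpp_pmf \<alpha> k x" and
          f = "\<lambda>z. ml \<alpha> (x * (z - 1))", OF _ _ _ m(2,1)])
      (use zero fpp_pmf_sums[OF \<alpha>(1), of x] in auto)
  have "ml \<alpha> (x * (- s - 1)) = ml \<alpha> (- (x * (s + 1)))"
    by (rule arg_cong) (simp add: algebra_simps)
  also have "\<dots> = 0" using s x by (intro beyond) auto
  finally show False using s(2)[of "- s"] s(1) by auto
qed

lemma has_bochner_integral_Beta:
  fixes a b t :: real
  assumes "a > 0" "b > 0" "t > 0"
  shows "has_bochner_integral lborel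
    (\<lambda>s. indicator {0<..<t} s * (s powr (a - 1) * (t - s) powr (b - 1)))
    (t powr (a + b - 1) * Beta a b)"
proof -
  have "(\<lambda>s. indicator {0<..<1} s * (s powr (a - 1) * (1 - s) powr (b - 1))) =
      (\<lambda>s. if s \<in> {0<..<1} then s powr (a - 1) * (1 - s) powr (b - 1) else 0)"
    by (auto simp: indicator_def)
  then have *: "((\<lambda>s. indicator {0<..<1} s * (s powr (a - 1) * (1 - s) powr (b - 1)))
      has_integral Beta a b) UNIV"
    using has_integral_Beta_real[OF assms(1,2)]
    by (simp only: has_integral_restrict_UNIV has_integral_Icc_iff_Ioo)
  have "Beta a b \<ge> 0" using assms by (simp add: Beta_def)
  then have "has_bochner_integral lborel (\<lambda>s. indicator {0<..<1} s * (s powr (a - 1) * (1 - s) powr (b - 1))) (Beta a b)"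
    using * by (intro has_bochner_integral_nn_integral nn_integral_has_integral_lborel) auto
  from lborel_has_bochner_integral_real_affine_iff[THEN iffD1, OF _ this, of "1 / t" 0]
  have "has_bochner_integral lborel
     (\<lambda>s. indicator {0<..<1} (s / t) * ((s / t) powr (a - 1) * (1 - s / t) powr (b - 1))) (t * Beta a b)"
    using assms by (simp add: inverse_eq_divide)
  then have "has_bochner_integral lborel
     (\<lambda>s. t powr (a + b - 2) * (indicator {0<..<1} (s / t) * ((s / t) powr (a - 1) * (1 - s / t) powr (b - 1))))
     (t powr (a + b - 2) * (t * Beta a b))"
    by (rule has_bochner_integral_mult_right)
  also have "t powr (a + b - 2) * (t * Beta a b) = t powr (a + b - 1) * Beta a b"
    using assms powr_add[of t "a + b - 2" 1] by (simp add: mult.assoc)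
  also have "(\<lambda>s. t powr (a + b - 2) * (indicator {0<..<1} (s / t) * ((s / t) powr (a - 1) * (1 - s / t) powr (b - 1)))) =
     (\<lambda>s. indicator {0<..<t} s * (s powr (a - 1) * (t - s) powr (b - 1)))"
  proof
    fix s
    show "t powr (a + b - 2) * (indicator {0<..<1} (s / t) * ((s / t) powr (a - 1) * (1 - s / t) powr (b - 1))) =
       indicator {0<..<t} s * (s powr (a - 1) * (t - s) powr (b - 1))"
    proof (cases "s \<in> {0<..<t}")
      case True
      have "t powr (a + b - 2) = t powr (a - 1) * t powr (b - 1)"
        by (simp add: powr_add [symmetric])
      moreover have "1 - s / t = (t - s) / t" using assms by (simp add: field_simps)
      ultimately show ?thesis
        using True assms by (simp add: powr_divide)
    qed (use assms in \<open>auto simp: indicator_def zero_less_divide_iff\<close>)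
  qed
  finally show ?thesis .
qed

section \<open>Convolution of power series in a fractional power of time\<close>

text \<open>
  Coefficients that grow at most geometrically. Against the coefficients of \<open>ml\<close>, such a series
  converges for all arguments.
\<close>

definition geom_bounded :: "real fps \<Rightarrow> bool" where
  "geom_bounded c \<longleftrightarrow> (\<exists>C K. C \<ge> 0 \<and> K \<ge> 0 \<and> (\<forall>i. \<bar>fps_nth c i\<bar> \<le> C * K ^ i))"

text \<open>
  The convolution of the moduli, not just the product series, is needed to justify the term-by-term
  integration in \<open>frac_convolution\<close>.
\<close>

lemma geom_bounded_mult_aux:
  assumes "geom_bounded a" "geom_bounded b"
  obtains C K where "C \<ge> 0" "K \<ge> 0"
    "\<And>n. (\<Sum>i\<le>n. \<bar>fps_nth a i\<bar> * \<bar>fps_nth b (n - i)\<bar>) \<le> C * K ^ n"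
proof -
  obtain C K where a: "C \<ge> 0" "K \<ge> 0" "\<And>i. \<bar>fps_nth a i\<bar> \<le> C * K ^ i"
    using assms by (auto simp: geom_bounded_def)
  obtain D L where b: "D \<ge> 0" "L \<ge> 0" "\<And>i. \<bar>fps_nth b i\<bar> \<le> D * L ^ i"
    using assms by (auto simp: geom_bounded_def)
  have "(\<Sum>i\<le>n. \<bar>fps_nth a i\<bar> * \<bar>fps_nth b (n - i)\<bar>) \<le> (C * D) * (2 * max K L) ^ n" for n
  proof -
    have "(\<Sum>i\<le>n. \<bar>fps_nth a i\<bar> * \<bar>fps_nth b (n - i)\<bar>)
        \<le> (\<Sum>i\<le>n. (C * max K L ^ i) * (D * max K L ^ (n - i)))"
    proof (intro sum_mono mult_mono)
      show "\<bar>fps_nth a i\<bar> \<le> C * max K L ^ i" for i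
        using a(3)[of i] mult_left_mono[OF power_mono[of K "max K L" i] a(1)] a(2) by linarith
      show "\<bar>fps_nth b i\<bar> \<le> D * max K L ^ i" for i
        using b(3)[of i] mult_left_mono[OF power_mono[of L "max K L" i] b(1)] b(2) by linarith
    qed (use a b in auto)
    also have "\<dots> = (\<Sum>i\<le>n. (C * D) * max K L ^ n)"
      by (intro sum.cong) (auto simp: power_add [symmetric] mult_ac)
    also have "\<dots> = (C * D) * (real (Suc n) * max K L ^ n)"
      by simp
    also have "\<dots> \<le> (C * D) * (2 ^ n * max K L ^ n)"
    proof (intro mult_left_mono mult_right_mono)
      show "real (Suc n) \<le> 2 ^ n"
        using less_exp[of n] by (metis Suc_leI of_nat_le_iff of_nat_numeral of_nat_power)
    qed (use a b in auto)
    finally show ?thesis by (simp add: power_mult_distrib)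
  qed
  then show ?thesis using that a b by (metis le_max_iff_disj mult_nonneg_nonneg zero_le_numeral)
qed

lemma geom_bounded_mult:
  assumes "geom_bounded a" "geom_bounded b"
  shows "geom_bounded (a * b)"
proof -
  obtain C K where CK: "C \<ge> 0" "K \<ge> 0"
      "\<And>n. (\<Sum>i\<le>n. \<bar>fps_nth a i\<bar> * \<bar>fps_nth b (n - i)\<bar>) \<le> C * K ^ n"
    using geom_bounded_mult_aux[OF assms] by metis
  have "\<bar>fps_nth (a * b) n\<bar> \<le> C * K ^ n" for n
  proof -
    have "\<bar>fps_nth (a * b) n\<bar> \<le> (\<Sum>i\<le>n. \<bar>fps_nth a i * fps_nth b (n - i)\<bar>)"
      unfolding fps_mult_nth atLeast0AtMost by (rule sum_abs)
    then show ?thesis using CK(3)[of n] by (simp add: abs_mult)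
  qed
  with CK show ?thesis by (auto simp: geom_bounded_def)
qed

lemma geom_bounded_1: "geom_bounded 1"
  unfolding geom_bounded_def by (intro exI[of _ 1]) auto

lemma geom_bounded_power: "geom_bounded a \<Longrightarrow> geom_bounded (a ^ n)"
  by (induction n) (auto intro: geom_bounded_mult geom_bounded_1)

lemma summable_geom_bounded:
  assumes "\<alpha> > 0" "geom_bounded c"
  shows "summable (\<lambda>i. \<bar>fps_nth c i * y ^ i * ml_coeff \<alpha> i\<bar>)"
proof -
  obtain C K where CK: "C \<ge> 0" "K \<ge> 0" "\<And>i. \<bar>fps_nth c i\<bar> \<le> C * K ^ i"
    using assms by (auto simp: geom_bounded_def)
  show ?thesis
  proof (rule summable_comparison_test')
    show "summable (\<lambda>i. C * ((K * \<bar>y\<bar>) ^ i * ml_coeff \<alpha> i))"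
      using assms CK by (intro summable_mult summable_ml_pos) auto
    show "norm \<bar>fps_nth c i * y ^ i * ml_coeff \<alpha> i\<bar> \<le> C * ((K * \<bar>y\<bar>) ^ i * ml_coeff \<alpha> i)" for i
    proof -
      have "norm \<bar>fps_nth c i * y ^ i * ml_coeff \<alpha> i\<bar> = \<bar>fps_nth c i\<bar> * (\<bar>y\<bar> ^ i * ml_coeff \<alpha> i)"
        using ml_coeff_pos[OF assms(1), of i] by (simp add: abs_mult power_abs)
      also have "\<dots> \<le> C * K ^ i * (\<bar>y\<bar> ^ i * ml_coeff \<alpha> i)"
        using CK ml_coeff_pos[OF assms(1), of i] by (intro mult_right_mono) auto
      finally show ?thesis by (simp add: power_mult_distrib mult_ac)
    qed
  qed
qed

text \<open>
  A formal power series \<open>c\<close> stands for the function with Laplace transform \<open>c (s powr (- \<alpha>)) / s\<close>. If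
  \<open>c (s powr (- \<alpha>))\<close> is the Laplace transform of a probability density, then \<open>frac_cdf\<close> is the
  distribution function and \<open>frac_pdf\<close> the density.
\<close>

definition frac_cdf :: "real \<Rightarrow> real fps \<Rightarrow> real \<Rightarrow> real" where
  "frac_cdf \<alpha> c t = (\<Sum>i. fps_nth c i * (t powr \<alpha>) ^ i * ml_coeff \<alpha> i)"

definition frac_pdf :: "real \<Rightarrow> real fps \<Rightarrow> real \<Rightarrow> real" where
  "frac_pdf \<alpha> c t = (\<Sum>i. fps_nth c i * (\<alpha> * real i / t * (t powr \<alpha>) ^ i * ml_coeff \<alpha> i))"

text \<open>
  The Beta integral: the density with transform \<open>s powr (- \<alpha> i)\<close>, convolved with the distribution
  function belonging to \<open>s powr (- \<alpha> j)\<close>. For \<open>i = 0\<close> the density is 0 instead of a unit mass at the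
  origin.
\<close>

lemma frac_kernel_convolution:
  assumes \<alpha>: "\<alpha> > 0" and t: "t > 0"
  shows "has_bochner_integral lborel
    (\<lambda>s. indicator {0<..<t} s * ((\<alpha> * real i / s * (s powr \<alpha>) ^ i * ml_coeff \<alpha> i) *
        (((t - s) powr \<alpha>) ^ j * ml_coeff \<alpha> j)))
    (if i = 0 then 0 else (t powr \<alpha>) ^ (i + j) * ml_coeff \<alpha> (i + j))"
proof (cases "i = 0")
  case False
  define a where "a = \<alpha> * real i"
  define b where "b = \<alpha> * real j + 1"
  have ab: "a > 0" "b > 0" using \<alpha> False by (auto simp: a_def b_def intro: add_nonneg_pos)
  have Ga: "Gamma (1 + a) = a * Gamma a" "Gamma a > 0" "Gamma b > 0"
    using ab Gamma_plus1[of a] nonpos_Ints_nonpos[of a] by (auto simp: add_ac intro: Gamma_real_pos)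
  have "has_bochner_integral lborel
     (\<lambda>s. (a * ml_coeff \<alpha> i * ml_coeff \<alpha> j) * (indicator {0<..<t} s * (s powr (a - 1) * (t - s) powr (b - 1))))
     ((a * ml_coeff \<alpha> i * ml_coeff \<alpha> j) * (t powr (a + b - 1) * Beta a b))"
    by (intro has_bochner_integral_mult_right has_bochner_integral_Beta ab t)
  also have "(\<lambda>s. (a * ml_coeff \<alpha> i * ml_coeff \<alpha> j) * (indicator {0<..<t} s * (s powr (a - 1) * (t - s) powr (b - 1)))) =
      (\<lambda>s. indicator {0<..<t} s * ((\<alpha> * real i / s * (s powr \<alpha>) ^ i * ml_coeff \<alpha> i) *
        (((t - s) powr \<alpha>) ^ j * ml_coeff \<alpha> j)))"
  proof
    fix s
    show "(a * ml_coeff \<alpha> i * ml_coeff \<alpha> j) * (indicator {0<..<t} s * (s powr (a - 1) * (t - s) powr (b - 1))) =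
      indicator {0<..<t} s * ((\<alpha> * real i / s * (s powr \<alpha>) ^ i * ml_coeff \<alpha> i) *
        (((t - s) powr \<alpha>) ^ j * ml_coeff \<alpha> j))"
    proof (cases "s \<in> {0<..<t}")
      case True
      have "(s powr \<alpha>) ^ i = s powr (a - 1) * s"
        using True powr_add[of s "a - 1" 1]
        by (simp add: a_def powr_realpow [symmetric] powr_powr)
      moreover have "((t - s) powr \<alpha>) ^ j = (t - s) powr (b - 1)"
        using True by (simp add: b_def powr_realpow [symmetric] powr_powr)
      ultimately show ?thesis using True by (simp add: a_def)
    qed auto
  qed
  also have "(a * ml_coeff \<alpha> i * ml_coeff \<alpha> j) * (t powr (a + b - 1) * Beta a b) =
      (t powr \<alpha>) ^ (i + j) * ml_coeff \<alpha> (i + j)"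
  proof -
    have "(t powr \<alpha>) ^ (i + j) = t powr (a + b - 1)"
      using t by (simp add: a_def b_def powr_realpow [symmetric] powr_powr algebra_simps)
    moreover have "a * ml_coeff \<alpha> i * ml_coeff \<alpha> j * Beta a b = ml_coeff \<alpha> (i + j)"
    proof -
      have "ml_coeff \<alpha> i = 1 / Gamma (1 + a)" "ml_coeff \<alpha> j = 1 / Gamma b" "ml_coeff \<alpha> (i + j) = 1 / Gamma (a + b)"
        by (simp_all add: ml_coeff_def a_def b_def algebra_simps)
      moreover have "Gamma a \<noteq> 0" "Gamma b \<noteq> 0" using Ga by linarith+
      ultimately show ?thesis using Ga(1) ab by (simp add: Beta_def)
    qed
    ultimately show ?thesis by (simp add: mult_ac)
  qed
  finally show ?thesis using False by simp
qed (simp add: has_bochner_integral_zero)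

text \<open>
  Convolution in time is multiplication of formal power series. The double series is arranged as a
  Cauchy product, so that one interchange of sum and integral suffices. The coefficient of index 0
  in \<open>a\<close> has to vanish, since a unit mass at the origin has no density.
\<close>

lemma frac_convolution:
  assumes \<alpha>: "\<alpha> > 0" and t: "t > 0"
    and a: "geom_bounded a" "fps_nth a 0 = 0" and b: "geom_bounded b"
  shows "has_bochner_integral lborel
     (\<lambda>s. indicator {0<..<t} s * (frac_pdf \<alpha> a s * frac_cdf \<alpha> b (t - s)))
     (frac_cdf \<alpha> (a * b) t)"
proof -
  define g where "g i s = \<alpha> * real i / s * (s powr \<alpha>) ^ i * ml_coeff \<alpha> i" for i s
  define e where "e j s = (s powr \<alpha>) ^ j * ml_coeff \<alpha> j" for j s
  define h where "h n s = indicator {0<..<t} s *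
      (\<Sum>i\<le>n. (fps_nth a i * g i s) * (fps_nth b (n - i) * e (n - i) (t - s)))" for n s
  define B where "B n = (t powr \<alpha>) ^ n * ml_coeff \<alpha> n" for n
  have g_nonneg: "g i s \<ge> 0" and e_nonneg: "e i s \<ge> 0" if "s > 0" for i s
    using \<alpha> that ml_coeff_pos[OF \<alpha>, of i] by (auto simp: g_def e_def less_imp_le)
  have ker: "has_bochner_integral lborel (\<lambda>s. indicator {0<..<t} s * (g i s * e j (t - s)))
      (if i = 0 then 0 else B (i + j))" for i j
    using frac_kernel_convolution[OF \<alpha> t, of i j] unfolding g_def e_def B_def .
  have h_int: "has_bochner_integral lborel (h n) (fps_nth (a * b) n * B n)" for n
  proof -
    have "has_bochner_integral lborel
       (\<lambda>s. \<Sum>i\<le>n. (fps_nth a i * fps_nth b (n - i)) * (indicator {0<..<t} s * (g i s * e (n - i) (t - s))))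
       (\<Sum>i\<le>n. (fps_nth a i * fps_nth b (n - i)) * (if i = 0 then 0 else B (i + (n - i))))"
      by (intro has_bochner_integral_sum has_bochner_integral_mult_right ker)
    also have "(\<Sum>i\<le>n. (fps_nth a i * fps_nth b (n - i)) * (if i = 0 then 0 else B (i + (n - i)))) =
       (\<Sum>i\<le>n. fps_nth a i * fps_nth b (n - i) * B n)"
      using a(2) by (intro sum.cong) auto
    also have "\<dots> = fps_nth (a * b) n * B n"
      by (simp add: sum_distrib_right fps_mult_nth atLeast0AtMost)
    also have "(\<lambda>s. \<Sum>i\<le>n. (fps_nth a i * fps_nth b (n - i)) * (indicator {0<..<t} s * (g i s * e (n - i) (t - s)))) = h n"
      by (auto simp: fun_eq_iff h_def sum_distrib_left mult_ac)
    finally show ?thesis .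
  qed
  \<comment> \<open>Termwise majorants of \<open>h\<close>, with the moduli of the coefficients.\<close>
  define h' where "h' n s = indicator {0<..<t} s *
      (\<Sum>i\<le>n. (\<bar>fps_nth a i\<bar> * g i s) * (\<bar>fps_nth b (n - i)\<bar> * e (n - i) (t - s)))" for n s
  have h'_int: "has_bochner_integral lborel (h' n)
      (\<Sum>i\<le>n. (\<bar>fps_nth a i\<bar> * \<bar>fps_nth b (n - i)\<bar>) * (if i = 0 then 0 else B (i + (n - i))))" for n
  proof -
    have "has_bochner_integral lborel
       (\<lambda>s. \<Sum>i\<le>n. (\<bar>fps_nth a i\<bar> * \<bar>fps_nth b (n - i)\<bar>) * (indicator {0<..<t} s * (g i s * e (n - i) (t - s))))
       (\<Sum>i\<le>n. (\<bar>fps_nth a i\<bar> * \<bar>fps_nth b (n - i)\<bar>) * (if i = 0 then 0 else B (i + (n - i))))"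
      by (intro has_bochner_integral_sum has_bochner_integral_mult_right ker)
    also have "(\<lambda>s. \<Sum>i\<le>n. (\<bar>fps_nth a i\<bar> * \<bar>fps_nth b (n - i)\<bar>) * (indicator {0<..<t} s * (g i s * e (n - i) (t - s)))) = h' n"
      by (auto simp: fun_eq_iff h'_def sum_distrib_left mult_ac)
    finally show ?thesis .
  qed
  have h_le: "norm (h n s) \<le> h' n s" for n s
  proof -
    have "\<bar>\<Sum>i\<le>n. (fps_nth a i * g i s) * (fps_nth b (n - i) * e (n - i) (t - s))\<bar> \<le>
        (\<Sum>i\<le>n. (\<bar>fps_nth a i\<bar> * g i s) * (\<bar>fps_nth b (n - i)\<bar> * e (n - i) (t - s)))" if "0 < s" "s < t"
      using that g_nonneg[of s] e_nonneg[of "t - s"]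
      by (intro order_trans[OF sum_abs] sum_mono) (auto simp: abs_mult abs_of_nonneg)
    then show ?thesis
      by (auto simp: h_def h'_def indicator_def)
  qed
  have sum_a: "summable (\<lambda>i. norm (fps_nth a i * g i s))" if "s > 0" for s
  proof -
    obtain C K where CK: "C \<ge> 0" "K \<ge> 0" "\<And>i. \<bar>fps_nth a i\<bar> \<le> C * K ^ i"
      using a by (auto simp: geom_bounded_def)
    show ?thesis
    proof (rule summable_comparison_test')
      show "summable (\<lambda>i. (C * \<alpha> / s) * ((2 * K * s powr \<alpha>) ^ i * ml_coeff \<alpha> i))"
        using \<alpha> CK by (intro summable_mult summable_ml_pos) auto
      fix i
      have "real i \<le> 2 ^ i" using less_exp[of i]
        by (metis less_imp_le of_nat_le_iff of_nat_numeral of_nat_power)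
      have "norm (norm (fps_nth a i * g i s)) = \<bar>fps_nth a i\<bar> * g i s"
        using g_nonneg[OF that] by (simp add: abs_mult)
      also have "\<dots> \<le> (C * K ^ i) * (\<alpha> * 2 ^ i / s * (s powr \<alpha>) ^ i * ml_coeff \<alpha> i)"
        unfolding g_def using CK \<open>real i \<le> 2 ^ i\<close> \<alpha> that ml_coeff_pos[OF \<alpha>, of i]
        by (intro mult_mono mult_right_mono divide_right_mono mult_left_mono) auto
      finally show "norm (norm (fps_nth a i * g i s)) \<le>
          (C * \<alpha> / s) * ((2 * K * s powr \<alpha>) ^ i * ml_coeff \<alpha> i)"
        by (simp add: power_mult_distrib mult_ac)
    qed
  qed
  have sum_b: "summable (\<lambda>i. norm (fps_nth b i * e i s))" for s
    using summable_geom_bounded[OF \<alpha> b, of "s powr \<alpha>"] by (simp add: e_def mult.assoc)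
  have h_sums: "summable (\<lambda>n. norm (h n s))"
      "(\<Sum>n. h n s) = indicator {0<..<t} s * (frac_pdf \<alpha> a s * frac_cdf \<alpha> b (t - s))" for s
  proof -
    show "summable (\<lambda>n. norm (h n s))"
    proof (cases "s \<in> {0<..<t}")
      case True
      have "summable (\<lambda>n. \<Sum>i\<le>n. norm (fps_nth a i * g i s) * norm (fps_nth b (n - i) * e (n - i) (t - s)))"
        using sum_a[of s] sum_b[of "t - s"] True by (intro summable_Cauchy_product) simp_all
      then show ?thesis
        by (rule summable_comparison_test')
          (use True in \<open>auto simp: h_def abs_mult intro!: order_trans[OF sum_abs] sum_mono\<close>)
    qed (simp add: h_def)
    show "(\<Sum>n. h n s) = indicator {0<..<t} s * (frac_pdf \<alpha> a s * frac_cdf \<alpha> b (t - s))"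
    proof (cases "s \<in> {0<..<t}")
      case True
      have "(\<Sum>i. fps_nth a i * g i s) * (\<Sum>j. fps_nth b j * e j (t - s)) =
          (\<Sum>n. \<Sum>i\<le>n. (fps_nth a i * g i s) * (fps_nth b (n - i) * e (n - i) (t - s)))"
        using True by (intro Cauchy_product sum_a sum_b) auto
      then show ?thesis
        using True by (simp add: h_def frac_pdf_def frac_cdf_def g_def e_def mult.assoc)
    qed (simp add: h_def)
  qed
  have h_norm: "summable (\<lambda>n. \<integral>s. norm (h n s) \<partial>lborel)"
  proof -
    obtain C K where CK: "C \<ge> 0" "K \<ge> 0"
      "\<And>n. (\<Sum>i\<le>n. \<bar>fps_nth a i\<bar> * \<bar>fps_nth b (n - i)\<bar>) \<le> C * K ^ n"
      using geom_bounded_mult_aux[OF a(1) b] by metis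
    have B_nonneg: "B n \<ge> 0" for n
      using ml_coeff_pos[OF \<alpha>, of n] by (simp add: B_def less_imp_le)
    show ?thesis
    proof (rule summable_comparison_test')
      show "summable (\<lambda>n. C * ((K * t powr \<alpha>) ^ n * ml_coeff \<alpha> n))"
        using \<alpha> CK by (intro summable_mult summable_ml_pos) auto
      fix n
      have "(\<integral>s. norm (h n s) \<partial>lborel) \<le> (\<integral>s. h' n s \<partial>lborel)"
        using h_le h_int h'_int
        by (intro integral_mono) (auto simp: has_bochner_integral_iff)
      also have "\<dots> = (\<Sum>i\<le>n. (\<bar>fps_nth a i\<bar> * \<bar>fps_nth b (n - i)\<bar>) * (if i = 0 then 0 else B (i + (n - i))))"
        using h'_int[of n] by (simp add: has_bochner_integral_iff)
      also have "\<dots> \<le> (\<Sum>i\<le>n. \<bar>fps_nth a i\<bar> * \<bar>fps_nth b (n - i)\<bar> * B n)"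
        using B_nonneg by (intro sum_mono mult_left_mono) auto
      also have "\<dots> \<le> C * K ^ n * B n"
        unfolding sum_distrib_right [symmetric] by (intro mult_right_mono CK B_nonneg)
      finally show "norm (\<integral>s. norm (h n s) \<partial>lborel) \<le> C * ((K * t powr \<alpha>) ^ n * ml_coeff \<alpha> n)"
        by (simp add: B_def power_mult_distrib mult_ac)
    qed
  qed
  have int: "integrable lborel (h n)" "integral\<^sup>L lborel (h n) = fps_nth (a * b) n * B n" for n
    using h_int[of n] by (auto simp: has_bochner_integral_iff)
  have "integrable lborel (\<lambda>s. \<Sum>n. h n s)"
    using int h_sums h_norm by (intro integrable_suminf) auto
  moreover have "(\<integral>s. (\<Sum>n. h n s) \<partial>lborel) = (\<Sum>n. fps_nth (a * b) n * B n)"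
    using int h_sums h_norm by (subst integral_suminf) auto
  ultimately show ?thesis
    by (simp add: h_sums has_bochner_integral_iff frac_cdf_def B_def mult.assoc)
qed

section \<open>The interarrival density as a convolution square\<close>

text \<open>
  The expansion of \<open>lam * X / (1 + lam * X)\<close>. With \<open>X = s powr (- \<alpha>)\<close> this is the Laplace transform
  \<open>lam / (lam + s powr \<alpha>)\<close> of the waiting times of the fractional Poisson process. Its square belongs
  to the waiting times in the theorem.
\<close>

definition laplace_fps :: "real \<Rightarrow> real fps" where
  "laplace_fps lam = Abs_fps (\<lambda>i. if i = 0 then 0 else - ((- lam) ^ i))"

definition laplace_denom :: "real \<Rightarrow> real fps" where
  "laplace_denom lam = 1 + fps_const lam * fps_X"

lemma laplace_denom_nz: "laplace_denom lam \<noteq> 0"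
proof
  assume "laplace_denom lam = 0"
  then have "fps_nth (laplace_denom lam) 0 = 0" by simp
  then show False by (simp add: laplace_denom_def)
qed

lemma nth_laplace_denom_mult:
  "fps_nth (laplace_denom lam * c) n = fps_nth c n + (if n = 0 then 0 else lam * fps_nth c (n - 1))"
  by (simp add: laplace_denom_def distrib_right mult.assoc)

lemma laplace_denom_fps: "laplace_denom lam * laplace_fps lam = fps_const lam * fps_X"
  by (rule fps_ext, subst nth_laplace_denom_mult) (auto simp: laplace_fps_def gr0_conv_Suc)

lemma geom_bounded_laplace: "geom_bounded (laplace_fps lam)"
  unfolding geom_bounded_def
  by (intro exI[of _ 1] exI[of _ "\<bar>lam\<bar>"]) (auto simp: laplace_fps_def power_abs)

text \<open>
  These are the transforms of the probabilities of exactly \<open>k\<close> events, that is, of at least \<open>k\<close> but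
  not at least \<open>k + 1\<close> events.
\<close>

lemma nth_laplace_power:
  "fps_nth ((1 - laplace_fps lam) * laplace_fps lam ^ k) i = real (i choose k) * (- 1) ^ (i + k) * lam ^ i"
proof -
  define B where "B k = Abs_fps (\<lambda>i. real (i choose k) * (- 1) ^ (i + k) * lam ^ i)" for k
  have "(1 - laplace_fps lam) * laplace_fps lam ^ k = B k"
  proof (induction k)
    case 0
    show ?case
      by (rule fps_ext) (auto simp: B_def laplace_fps_def power_minus[of lam])
  next
    case (Suc k)
    have "laplace_denom lam * ((1 - laplace_fps lam) * laplace_fps lam ^ Suc k) =
        (laplace_denom lam * laplace_fps lam) * ((1 - laplace_fps lam) * laplace_fps lam ^ k)"
      by (simp add: mult_ac)
    also have "\<dots> = fps_const lam * fps_X * B k"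
      by (simp only: laplace_denom_fps Suc)
    also have "\<dots> = laplace_denom lam * B (Suc k)"
    proof (rule fps_ext)
      fix n show "fps_nth (fps_const lam * fps_X * B k) n = fps_nth (laplace_denom lam * B (Suc k)) n"
        by (subst nth_laplace_denom_mult, cases n) (simp_all add: B_def mult.assoc algebra_simps)
    qed
    finally show ?case using laplace_denom_nz by simp
  qed
  then show ?thesis by (simp add: B_def)
qed

lemma nth_laplace_square: "real i * fps_nth (laplace_fps lam ^ 2) i = 2 * real (i choose 2) * (- lam) ^ i"
proof -
  define D where "D = Abs_fps (\<lambda>i. if i = 0 then 0 else (real i - 1) * (- lam) ^ i)"
  have "laplace_denom lam * laplace_fps lam ^ 2 = (laplace_denom lam * laplace_fps lam) * laplace_fps lam"
    by (simp add: power2_eq_square mult_ac)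
  also have "\<dots> = fps_const lam * fps_X * laplace_fps lam"
    by (simp only: laplace_denom_fps)
  also have "\<dots> = laplace_denom lam * D"
  proof (rule fps_ext)
    fix n show "fps_nth (fps_const lam * fps_X * laplace_fps lam) n = fps_nth (laplace_denom lam * D) n"
      by (subst nth_laplace_denom_mult, cases n) (auto simp: D_def laplace_fps_def mult.assoc algebra_simps gr0_conv_Suc)
  qed
  finally have "laplace_fps lam ^ 2 = D" using laplace_denom_nz by simp
  moreover have "real (i choose 2) * 2 = real i * (real i - 1)"
    by (cases i) (auto simp: choose_two real_of_nat_div algebra_simps)
  ultimately show ?thesis by (auto simp: D_def)
qed

lemma frac_cdf_1: "frac_cdf \<alpha> 1 t = 1"
proof -
  have "(\<lambda>i. fps_nth 1 i * (t powr \<alpha>) ^ i * ml_coeff \<alpha> i) = (\<lambda>i. if i = 0 then 1 else 0)"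
    by (auto simp: ml_coeff_def)
  then show ?thesis
    using sums_single[of 0 "\<lambda>_. 1::real"] by (simp add: frac_cdf_def sums_iff)
qed

lemma frac_cdf_laplace_diff:
  assumes \<alpha>: "\<alpha> > 0"
  shows "frac_cdf \<alpha> (laplace_fps lam ^ k) t - frac_cdf \<alpha> (laplace_fps lam ^ Suc k) t = fpp_pmf \<alpha> k (lam * t powr \<alpha>)"
proof -
  have "summable (\<lambda>i. fps_nth (laplace_fps lam ^ k) i * (t powr \<alpha>) ^ i * ml_coeff \<alpha> i)" for k
    using summable_geom_bounded[OF \<alpha> geom_bounded_power[OF geom_bounded_laplace], of lam k "t powr \<alpha>"]
    by (rule summable_rabs_cancel)
  from suminf_diff[OF this this, of k "Suc k"]
  have "frac_cdf \<alpha> (laplace_fps lam ^ k) t - frac_cdf \<alpha> (laplace_fps lam ^ Suc k) t =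
      (\<Sum>i. fps_nth (laplace_fps lam ^ k) i * (t powr \<alpha>) ^ i * ml_coeff \<alpha> i -
        fps_nth (laplace_fps lam ^ Suc k) i * (t powr \<alpha>) ^ i * ml_coeff \<alpha> i)"
    by (simp add: frac_cdf_def)
  also have "\<dots> = fpp_pmf \<alpha> k (lam * t powr \<alpha>)"
    unfolding fpp_pmf_def
  proof (rule suminf_cong)
    fix i
    have "fps_nth (laplace_fps lam ^ k) i - fps_nth (laplace_fps lam ^ Suc k) i =
        real (i choose k) * (- 1) ^ (i + k) * lam ^ i"
      by (subst nth_laplace_power [symmetric]) (simp add: left_diff_distrib)
    then show "fps_nth (laplace_fps lam ^ k) i * (t powr \<alpha>) ^ i * ml_coeff \<alpha> i -
        fps_nth (laplace_fps lam ^ Suc k) i * (t powr \<alpha>) ^ i * ml_coeff \<alpha> i =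
        real (i choose k) * (- 1) ^ (i + k) * (lam * t powr \<alpha>) ^ i * ml_coeff \<alpha> i"
      by (simp only: left_diff_distrib [symmetric] power_mult_distrib mult.assoc)
  qed
  finally show ?thesis .
qed

text \<open>
  Expressing the density through \<open>fpp_pmf\<close> makes its nonnegativity a case of \<open>fpp_pmf_nonneg\<close>.
\<close>

lemma frac_pdf_laplace_square:
  "frac_pdf \<alpha> (laplace_fps lam ^ 2) s = 2 * \<alpha> / s * fpp_pmf \<alpha> 2 (lam * s powr \<alpha>)" if "\<alpha> > 0"
proof -
  have "2 * \<alpha> / s * fpp_pmf \<alpha> 2 (lam * s powr \<alpha>) =
      (\<Sum>i. 2 * \<alpha> / s * (real (i choose 2) * (- 1) ^ (i + 2) * (lam * s powr \<alpha>) ^ i * ml_coeff \<alpha> i))"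
    unfolding fpp_pmf_def by (rule suminf_mult [symmetric]) (rule summable_norm_cancel[OF summable_norm_fpp_pmf[OF that]])
  also have "\<dots> = frac_pdf \<alpha> (laplace_fps lam ^ 2) s"
    unfolding frac_pdf_def
  proof (rule suminf_cong)
    fix i
    have "fps_nth (laplace_fps lam ^ 2) i * (\<alpha> * real i / s * (s powr \<alpha>) ^ i * ml_coeff \<alpha> i) =
        (real i * fps_nth (laplace_fps lam ^ 2) i) * (\<alpha> / s * (s powr \<alpha>) ^ i * ml_coeff \<alpha> i)"
      by simp
    also have "\<dots> = 2 * \<alpha> / s * (real (i choose 2) * (- 1) ^ (i + 2) * (lam * s powr \<alpha>) ^ i * ml_coeff \<alpha> i)"
      unfolding nth_laplace_square by (simp add: power_minus[of lam] power_mult_distrib)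
    finally show "2 * \<alpha> / s * (real (i choose 2) * (- 1) ^ (i + 2) * (lam * s powr \<alpha>) ^ i * ml_coeff \<alpha> i) =
       fps_nth (laplace_fps lam ^ 2) i * (\<alpha> * real i / s * (s powr \<alpha>) ^ i * ml_coeff \<alpha> i)" ..
  qed
  finally show ?thesis ..
qed

lemma interarrival_density_eq:
  assumes \<alpha>: "\<alpha> > 0" and s: "s > 0"
  shows "interarrival_density lam \<alpha> s = 2 * \<alpha> / s * fpp_pmf \<alpha> 2 (lam * s powr \<alpha>)"
proof -
  define x where "x = lam * s powr \<alpha>"
  define u where "u i = real (i choose 2) * (- 1) ^ (i + 2) * x ^ i * ml_coeff \<alpha> i" for i
  define v where "v j = Gamma (real j + 2) * (- x) ^ j / (fact j * Gamma (real j * \<alpha> + 2 * \<alpha>))" for j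
  have pows: "s powr (2 * \<alpha> - 1) = (s powr \<alpha>)\<^sup>2 / s"
    using s by (simp add: powr_diff powr_realpow [symmetric] powr_powr mult.commute)
  have "u sums fpp_pmf \<alpha> 2 x"
    unfolding u_def fpp_pmf_def by (rule summable_sums[OF summable_norm_cancel[OF summable_norm_fpp_pmf[OF \<alpha>]]])
  then have "(\<lambda>j. u (j + 2)) sums (fpp_pmf \<alpha> 2 x - (\<Sum>i<2. u i))"
    by (rule sums_split_initial_segment)
  then have "(\<lambda>j. 2 * \<alpha> * u (j + 2)) sums (2 * \<alpha> * fpp_pmf \<alpha> 2 x)"
    by (intro sums_mult) (simp add: u_def eval_nat_numeral)
  also have "(\<lambda>j. 2 * \<alpha> * u (j + 2)) = (\<lambda>j. x\<^sup>2 * v j)"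
  proof
    fix j
    define a where "a = real j * \<alpha> + 2 * \<alpha>"
    have a: "a > 0" using \<alpha> by (simp add: a_def add_nonneg_pos)
    have G: "Gamma (1 + \<alpha> * real (j + 2)) = a * Gamma a"
      using Gamma_plus1[of a] nonpos_Ints_nonpos[of a] a by (auto simp: a_def algebra_simps)
    have "Gamma (real j + 2) = (real j + 1) * fact j"
      using Gamma_fact[of "Suc j", where 'a = real] by (simp add: add_ac)
    then have v: "v j = (real j + 1) * (- x) ^ j / Gamma a"
      unfolding v_def a_def [symmetric] by simp
    have "real ((j + 2) choose 2) * 2 = (real j + 2) * (real j + 1)"
    proof -
      have "((j + 2) choose 2) * 2 = (j + 2) * (j + 1)"
        by (simp add: choose_two)
      from arg_cong[OF this, of real] show ?thesis
        by (simp only: of_nat_mult of_nat_add of_nat_numeral of_nat_1)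
    qed
    then have "2 * \<alpha> * u (j + 2) = ((real j + 2) * \<alpha>) * (real j + 1) * (- 1) ^ j * x ^ (j + 2) * ml_coeff \<alpha> (j + 2)"
      by (simp add: u_def mult_ac)
    also have "(real j + 2) * \<alpha> = a"
      by (simp add: a_def algebra_simps)
    also have "ml_coeff \<alpha> (j + 2) = 1 / (a * Gamma a)"
      unfolding ml_coeff_def G ..
    also have "a * (real j + 1) * (- 1) ^ j * x ^ (j + 2) * (1 / (a * Gamma a)) = x\<^sup>2 * v j"
      using a by (simp add: v power_add power2_eq_square power_minus[of x])
    finally show "2 * \<alpha> * u (j + 2) = x\<^sup>2 * v j" .
  qed
  finally have "(\<lambda>j. x\<^sup>2 * v j) sums (2 * \<alpha> * fpp_pmf \<alpha> 2 x)" .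
  then have "x\<^sup>2 * suminf v = 2 * \<alpha> * fpp_pmf \<alpha> 2 x"
  proof (cases "x = 0")
    case True
    then show ?thesis by (simp add: fpp_pmf_def power_0_left binomial_eq_0 if_distrib cong: if_cong)
  next
    case False
    assume "(\<lambda>j. x\<^sup>2 * v j) sums (2 * \<alpha> * fpp_pmf \<alpha> 2 x)"
    from sums_mult[OF this, of "1 / x\<^sup>2"] have "v sums (2 * \<alpha> * fpp_pmf \<alpha> 2 x / x\<^sup>2)"
      using False by simp
    then show ?thesis using False by (simp add: sums_iff)
  qed
  moreover have "interarrival_density lam \<alpha> s = x\<^sup>2 * suminf v / s"
    using s by (simp add: interarrival_density_def mittag_leffler3_def pows x_def v_def[abs_def]
        power_mult_distrib Gamma_numeral)
  ultimately show ?thesis by (simp add: x_def)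
qed

lemma interarrival_density_nonneg:
  assumes "0 < \<alpha>" "\<alpha> \<le> 1" "lam > 0"
  shows "interarrival_density lam \<alpha> s \<ge> 0"
proof (cases "s > 0")
  case True
  then show ?thesis
    using assms fpp_pmf_nonneg[of \<alpha> "lam * s powr \<alpha>" 2] by (simp add: interarrival_density_eq)
qed (simp add: interarrival_density_def)

text \<open>
  By telescoping, since the probabilities \<open>fpp_pmf\<close> add up to \<open>ml \<alpha> 0 = 1\<close>.
\<close>

lemma frac_cdf_laplace_tendsto:
  assumes "\<alpha> > 0"
  shows "(\<lambda>k. frac_cdf \<alpha> (laplace_fps lam ^ k) t) \<longlonglongrightarrow> 0"
proof -
  have "(\<Sum>k<n. fpp_pmf \<alpha> k (lam * t powr \<alpha>)) = 1 - frac_cdf \<alpha> (laplace_fps lam ^ n) t" for n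
    by (induction n) (simp_all add: frac_cdf_1 frac_cdf_laplace_diff[OF assms, symmetric])
  then have "(\<lambda>n. 1 - frac_cdf \<alpha> (laplace_fps lam ^ n) t) \<longlonglongrightarrow> 1"
    using fpp_pmf_sums[OF assms, of "lam * t powr \<alpha>" 1] by (simp add: sums_def)
  from tendsto_diff[OF tendsto_const[of 1] this] show ?thesis by simp
qed

section \<open>The law of the renewal count\<close>

locale ml_renewal = prob_space +
  fixes T :: "nat \<Rightarrow> 'a \<Rightarrow> real" and lam \<alpha> :: real
  assumes lam: "lam > 0" and \<alpha>: "0 < \<alpha>" "\<alpha> \<le> 1"
    and indep: "indep_vars (\<lambda>_. borel) T UNIV"
    and dist: "\<And>i. distributed M lborel (T i) (\<lambda>s. ennreal (interarrival_density lam \<alpha> s))"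
begin

lemma T_measurable [measurable]: "T i \<in> borel_measurable M"
  using distributed_measurable[OF dist[of i]] by simp

lemma AE_T_pos: "AE \<omega> in M. \<forall>i. T i \<omega> > 0"
proof (subst AE_all_countable, intro allI)
  fix i
  have "emeasure M (T i -` {..0} \<inter> space M) =
      (\<integral>\<^sup>+s. ennreal (interarrival_density lam \<alpha> s) * indicator {..0} s \<partial>lborel)"
    by (rule distributed_emeasure[OF dist]) auto
  also have "\<dots> = (\<integral>\<^sup>+s. 0 \<partial>(lborel :: real measure))"
    by (intro nn_integral_cong) (auto simp: interarrival_density_def indicator_def)
  finally have "T i -` {..0} \<inter> space M \<in> null_sets M"
    by (auto simp: null_sets_def)
  then have "AE \<omega> in M. \<omega> \<notin> T i -` {..0} \<inter> space M"
    by (rule AE_not_in)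
  then show "AE \<omega> in M. T i \<omega> > 0"
    by (rule AE_mp) (auto intro!: AE_I2)
qed

text \<open>
  Conditioning on the last waiting time.
\<close>

lemma prob_sum_Suc:
  "emeasure M {\<omega> \<in> space M. (\<Sum>i<Suc n. T i \<omega>) \<le> t} =
   (\<integral>\<^sup>+s. ennreal (interarrival_density lam \<alpha> s) *
      emeasure M {\<omega> \<in> space M. (\<Sum>i<n. T i \<omega>) \<le> t - s} \<partial>lborel)"
proof -
  let ?S = "\<lambda>\<omega>. \<Sum>i<n. T i \<omega>"
  have "indep_vars (\<lambda>_. borel) T (insert n {..<n})"
    using indep by (rule indep_vars_subset) auto
  then have iv: "indep_var borel (T n) borel ?S"
    by (intro indep_vars_sum) auto
  interpret D1: prob_space "distr M borel (T n)" by (rule prob_space_distr) simp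
  interpret D2: prob_space "distr M borel ?S" by (rule prob_space_distr) simp
  have "emeasure M {\<omega> \<in> space M. (\<Sum>i<Suc n. T i \<omega>) \<le> t} =
      emeasure (distr M borel (\<lambda>\<omega>. T n \<omega> + ?S \<omega>)) {..t}"
    by (subst emeasure_distr) (auto intro!: arg_cong[where f = "emeasure M"] simp: add.commute)
  also have "\<dots> = emeasure (distr M borel (T n) \<star> distr M borel ?S) {..t}"
    by (subst sum_indep_random_variable[OF iv]) auto
  also have "\<dots> = (\<integral>\<^sup>+s. emeasure (distr M borel ?S) {a. a + s \<in> {..t}} \<partial>distr M borel (T n))"
    by (rule convolution_emeasure)
      (auto simp: D1.finite_measure_axioms D2.finite_measure_axioms)
  also have "\<dots> = (\<integral>\<^sup>+s. emeasure M {\<omega> \<in> space M. ?S \<omega> \<le> t - s} \<partial>distr M borel (T n))"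
    by (intro nn_integral_cong, subst emeasure_distr)
      (auto intro!: arg_cong[where f = "emeasure M"] simp: algebra_simps)
  also have "distr M borel (T n) = distr M lborel (T n)"
    by (rule distr_cong) auto
  also have "\<dots> = density lborel (\<lambda>s. ennreal (interarrival_density lam \<alpha> s))"
    by (rule distributed_distr_eq_density[OF dist])
  also have "(\<integral>\<^sup>+s. emeasure M {\<omega> \<in> space M. ?S \<omega> \<le> t - s} \<partial>density lborel (\<lambda>s. ennreal (interarrival_density lam \<alpha> s))) =
     (\<integral>\<^sup>+s. ennreal (interarrival_density lam \<alpha> s) * emeasure M {\<omega> \<in> space M. ?S \<omega> \<le> t - s} \<partial>lborel)"
  proof (rule nn_integral_density)
    show "(\<lambda>s. ennreal (interarrival_density lam \<alpha> s)) \<in> borel_measurable lborel"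
      using distributed_borel_measurable[OF dist[of n]] .
    show "(\<lambda>s. emeasure M {\<omega> \<in> space M. ?S \<omega> \<le> t - s}) \<in> borel_measurable lborel"
      by measurable
  qed
  finally show ?thesis .
qed

text \<open>
  The sum of \<open>n\<close> waiting times has the transform \<open>laplace_fps lam ^ (2 * n)\<close>. Both parts are proved
  together by induction, because the convolution integrand has to be nonnegative for its Bochner
  integral to agree with the extended nonnegative one.
\<close>

lemma prob_sum_le:
  assumes "t > 0"
  shows "emeasure M {\<omega> \<in> space M. (\<Sum>i<n. T i \<omega>) \<le> t} = ennreal (frac_cdf \<alpha> (laplace_fps lam ^ (2 * n)) t)"
    and "frac_cdf \<alpha> (laplace_fps lam ^ (2 * n)) t \<ge> 0"
proof -
  have "emeasure M {\<omega> \<in> space M. (\<Sum>i<n. T i \<omega>) \<le> t} = ennreal (frac_cdf \<alpha> (laplace_fps lam ^ (2 * n)) t) \<and>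
      frac_cdf \<alpha> (laplace_fps lam ^ (2 * n)) t \<ge> 0"
    using assms
  proof (induction n arbitrary: t)
    case 0
    then show ?case by (simp add: frac_cdf_1 emeasure_space_1)
  next
    case (Suc n)
    let ?h = "\<lambda>s. indicator {0<..<t} s * (frac_pdf \<alpha> (laplace_fps lam ^ 2) s * frac_cdf \<alpha> (laplace_fps lam ^ (2 * n)) (t - s))"
    have h_nonneg: "?h s \<ge> 0" for s
    proof (cases "s \<in> {0<..<t}")
      case True
      then have "frac_pdf \<alpha> (laplace_fps lam ^ 2) s = interarrival_density lam \<alpha> s"
        using \<alpha> by (simp add: interarrival_density_eq frac_pdf_laplace_square)
      moreover have "frac_cdf \<alpha> (laplace_fps lam ^ (2 * n)) (t - s) \<ge> 0"
        using Suc.IH[of "t - s"] True by simp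
      ultimately show ?thesis
        using interarrival_density_nonneg[OF \<alpha> lam, of s] by simp
    qed simp
    have "fps_nth (laplace_fps lam ^ 2) 0 = 0"
      by (simp add: power2_eq_square laplace_fps_def)
    then have "has_bochner_integral lborel ?h (frac_cdf \<alpha> (laplace_fps lam ^ 2 * laplace_fps lam ^ (2 * n)) t)"
      using Suc.prems by (intro frac_convolution \<alpha> geom_bounded_power geom_bounded_laplace)
    then have hb: "integrable lborel ?h"
        "integral\<^sup>L lborel ?h = frac_cdf \<alpha> (laplace_fps lam ^ 2 * laplace_fps lam ^ (2 * n)) t"
      by (simp_all add: has_bochner_integral_iff)
    have neg: "emeasure M {\<omega> \<in> space M. (\<Sum>i<n. T i \<omega>) \<le> u} = 0" if "u < 0" for u
    proof -
      have "AE \<omega> in M. \<not> (\<Sum>i<n. T i \<omega>) \<le> u"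
        using AE_T_pos
      proof eventually_elim
        case (elim \<omega>)
        then have "(\<Sum>i<n. T i \<omega>) \<ge> 0" by (intro sum_nonneg) (auto intro: less_imp_le)
        then show ?case using that by simp
      qed
      then show ?thesis by (intro emeasure_eq_0_AE)
    qed
    have "emeasure M {\<omega> \<in> space M. (\<Sum>i<Suc n. T i \<omega>) \<le> t} =
       (\<integral>\<^sup>+s. ennreal (interarrival_density lam \<alpha> s) *
          emeasure M {\<omega> \<in> space M. (\<Sum>i<n. T i \<omega>) \<le> t - s} \<partial>lborel)"
      by (rule prob_sum_Suc)
    also have "\<dots> = (\<integral>\<^sup>+s. ennreal (?h s) \<partial>lborel)"
    proof (rule nn_integral_cong_AE)
      show "AE s in lborel. ennreal (interarrival_density lam \<alpha> s) *
          emeasure M {\<omega> \<in> space M. (\<Sum>i<n. T i \<omega>) \<le> t - s} = ennreal (?h s)"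
        using AE_lborel_singleton[of t]
      proof eventually_elim
        case (elim s)
        consider "s \<le> 0" | "0 < s" "s < t" | "t < s" using elim by linarith
        then show ?case
        proof cases
          case 2
          then have "emeasure M {\<omega> \<in> space M. (\<Sum>i<n. T i \<omega>) \<le> t - s} =
              ennreal (frac_cdf \<alpha> (laplace_fps lam ^ (2 * n)) (t - s))"
            using Suc.IH[of "t - s"] by simp
          moreover have "interarrival_density lam \<alpha> s = frac_pdf \<alpha> (laplace_fps lam ^ 2) s"
            using 2 \<alpha> by (simp add: interarrival_density_eq frac_pdf_laplace_square)
          ultimately show ?thesis
            using 2 interarrival_density_nonneg[OF \<alpha> lam, of s] by (simp add: ennreal_mult')
        qed (use neg in \<open>auto simp: interarrival_density_def\<close>)
      qed
    qed
    also have "\<dots> = ennreal (frac_cdf \<alpha> (laplace_fps lam ^ 2 * laplace_fps lam ^ (2 * n)) t)"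
      using nn_integral_eq_integral[OF hb(1) AE_I2[OF h_nonneg]] hb(2) by simp
    finally have "emeasure M {\<omega> \<in> space M. (\<Sum>i<Suc n. T i \<omega>) \<le> t} =
        ennreal (frac_cdf \<alpha> (laplace_fps lam ^ (2 * Suc n)) t)"
      by (simp add: power_add [symmetric])
    moreover have "frac_cdf \<alpha> (laplace_fps lam ^ (2 * Suc n)) t \<ge> 0"
    proof -
      have "integral\<^sup>L lborel ?h \<ge> 0" using h_nonneg by (intro integral_nonneg_AE AE_I2)
      then show ?thesis by (simp add: hb(2) power_add [symmetric])
    qed
    ultimately show ?case by blast
  qed
  then show "emeasure M {\<omega> \<in> space M. (\<Sum>i<n. T i \<omega>) \<le> t} = ennreal (frac_cdf \<alpha> (laplace_fps lam ^ (2 * n)) t)"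
    and "frac_cdf \<alpha> (laplace_fps lam ^ (2 * n)) t \<ge> 0" by auto
qed

lemma renewal_count_measurable [measurable]: "renewal_count T t \<in> measurable M (count_space UNIV)"
  unfolding renewal_count_def[abs_def] by measurable

text \<open>
  Almost surely the partial sums increase strictly and exceed \<open>t\<close> eventually, so the count is \<open>n\<close>
  exactly if the \<open>n\<close>-th sum is at most \<open>t\<close> and the next one is not. The difference of the two
  distribution functions splits into two fractional Poisson probabilities, because one waiting time
  here consists of two there.
\<close>

lemma prob_renewal_count:
  assumes t: "t > 0"
  shows "prob {\<omega> \<in> space M. renewal_count T t \<omega> = n} =
    fpp_pmf \<alpha> (2 * n) (lam * t powr \<alpha>) + fpp_pmf \<alpha> (2 * n + 1) (lam * t powr \<alpha>)"
proof -
  define S where "S n \<omega> = (\<Sum>i<n. T i \<omega>)" for n \<omega>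
  define F where "F n = frac_cdf \<alpha> (laplace_fps lam ^ (2 * n)) t" for n
  have S_meas [measurable]: "S n \<in> borel_measurable M" for n
    unfolding S_def[abs_def] by measurable
  have F: "prob {\<omega> \<in> space M. S n \<omega> \<le> t} = F n" for n
    using prob_sum_le[OF t, of n] by (simp add: S_def F_def measure_def)
  have F_lim: "F \<longlonglongrightarrow> 0"
    using LIMSEQ_subseq_LIMSEQ[OF frac_cdf_laplace_tendsto[OF \<alpha>(1), of lam t], of "\<lambda>n. 2 * n"]
    by (simp add: F_def[abs_def] o_def strict_mono_def)
  have AE_exceeds: "AE \<omega> in M. \<exists>n. S n \<omega> > t"
  proof -
    have "prob {\<omega> \<in> space M. \<forall>n. S n \<omega> \<le> t} \<le> F n" for n
      unfolding F [symmetric] by (intro finite_measure_mono) auto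
    then have "prob {\<omega> \<in> space M. \<forall>n. S n \<omega> \<le> t} \<le> 0"
      by (intro tendsto_lowerbound[OF F_lim always_eventually]) auto
    then have "prob {\<omega> \<in> space M. \<forall>n. S n \<omega> \<le> t} = 0"
      by (simp add: measure_le_0_iff)
    then have "AE \<omega> in M. \<not> (\<forall>n. S n \<omega> \<le> t)"
      by (subst (asm) prob_eq_0) auto
    then show ?thesis by (auto simp: not_le)
  qed
  have AE_iff: "AE \<omega> in M. renewal_count T t \<omega> = n \<longleftrightarrow> S n \<omega> \<le> t \<and> \<not> S (Suc n) \<omega> \<le> t" for n
    using AE_T_pos AE_exceeds
  proof eventually_elim
    case (elim \<omega>)
    have mono: "S i \<omega> \<le> S j \<omega>" if "i \<le> j" for i j
      unfolding S_def using that elim by (intro sum_mono2) (auto intro: less_imp_le)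
    define N where "N = (LEAST n. S n \<omega> > t)"
    have N: "S N \<omega> > t" "\<And>n. n < N \<Longrightarrow> S n \<omega> \<le> t"
    proof -
      show "S N \<omega> > t"
        unfolding N_def by (rule LeastI_ex) (use elim in blast)
      show "S n \<omega> \<le> t" if "n < N" for n
        using not_less_Least[of n "\<lambda>n. S n \<omega> > t"] that unfolding N_def by (simp only: not_less)
    qed
    have N_pos: "N > 0" using N(1) t by (cases N) (auto simp: S_def)
    have le_iff: "S n \<omega> \<le> t \<longleftrightarrow> n < N" for n
    proof (cases "n < N")
      case False
      then have "t < S n \<omega>" using N(1) mono[of N n] by linarith
      with False show ?thesis by simp
    qed (simp add: N)
    have "{n. n \<ge> 1 \<and> (\<Sum>i<n. T i \<omega>) \<le> t} = {1..<N}"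
      unfolding S_def [symmetric] le_iff by auto
    then have "renewal_count T t \<omega> = N - 1"
      by (simp add: renewal_count_def)
    then show ?case using N_pos by (auto simp: le_iff)
  qed
  have "prob {\<omega> \<in> space M. renewal_count T t \<omega> = n} =
      prob ({\<omega> \<in> space M. S n \<omega> \<le> t} - {\<omega> \<in> space M. S (Suc n) \<omega> \<le> t})"
    using AE_iff[of n] by (intro measure_eq_AE) auto
  also have "\<dots> = prob {\<omega> \<in> space M. S n \<omega> \<le> t} - prob ({\<omega> \<in> space M. S n \<omega> \<le> t} \<inter> {\<omega> \<in> space M. S (Suc n) \<omega> \<le> t})"
    by (subst finite_measure_Diff' [symmetric]) auto
  also have "prob ({\<omega> \<in> space M. S n \<omega> \<le> t} \<inter> {\<omega> \<in> space M. S (Suc n) \<omega> \<le> t}) =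
      prob {\<omega> \<in> space M. S (Suc n) \<omega> \<le> t}"
  proof (rule measure_eq_AE)
    show "AE \<omega> in M. \<omega> \<in> {\<omega> \<in> space M. S n \<omega> \<le> t} \<inter> {\<omega> \<in> space M. S (Suc n) \<omega> \<le> t} \<longleftrightarrow>
        \<omega> \<in> {\<omega> \<in> space M. S (Suc n) \<omega> \<le> t}"
      using AE_T_pos
    proof eventually_elim
      case (elim \<omega>)
      have "S (Suc n) \<omega> = S n \<omega> + T n \<omega>" by (simp add: S_def)
      moreover have "T n \<omega> > 0" using elim by blast
      ultimately show ?case by auto
    qed
  qed auto
  also have "prob {\<omega> \<in> space M. S n \<omega> \<le> t} - prob {\<omega> \<in> space M. S (Suc n) \<omega> \<le> t} =
      (frac_cdf \<alpha> (laplace_fps lam ^ (2 * n)) t - frac_cdf \<alpha> (laplace_fps lam ^ Suc (2 * n)) t) +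
      (frac_cdf \<alpha> (laplace_fps lam ^ Suc (2 * n)) t - frac_cdf \<alpha> (laplace_fps lam ^ Suc (Suc (2 * n))) t)"
    unfolding F by (simp add: F_def)
  also have "\<dots> = fpp_pmf \<alpha> (2 * n) (lam * t powr \<alpha>) + fpp_pmf \<alpha> (2 * n + 1) (lam * t powr \<alpha>)"
    unfolding frac_cdf_laplace_diff[OF \<alpha>(1)] by simp
  finally show ?thesis .
qed

end

section \<open>Infinitely divisible laws on the natural numbers\<close>

lemma Nats_borel [measurable]: "(\<nat> :: real set) \<in> sets borel"
  by (rule sets.countable) (auto simp: Nats_def)

lemma sum_in_Nats:
  fixes f :: "'i \<Rightarrow> 'b::semiring_1"
  assumes "\<And>i. i \<in> A \<Longrightarrow> f i \<in> \<nat>"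
  shows "sum f A \<in> \<nat>"
  using assms by (induction A rule: infinite_finite_induct) auto

lemma indep_vars_PiM_coordinates:
  assumes "\<And>i. i \<in> I \<Longrightarrow> prob_space (N i)" "I \<noteq> {}"
  shows "prob_space.indep_vars (PiM I N) N (\<lambda>i x. x i) I"
proof -
  interpret P: prob_space "PiM I N" by (rule prob_space_PiM) (rule assms)
  have "distr (PiM I N) (PiM I N) (\<lambda>x. \<lambda>i\<in>I. x i) = distr (PiM I N) (PiM I N) (\<lambda>x. x)"
    by (intro distr_cong refl) (auto simp: space_PiM)
  also have "\<dots> = PiM I (\<lambda>i. distr (PiM I N) (N i) (\<lambda>x. x i))"
    by (simp, intro PiM_cong refl) (use assms in \<open>simp add: distr_PiM_component\<close>)
  finally show ?thesis
    using assms(2) by (subst P.indep_vars_iff_distr_eq_PiM') auto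
qed

text \<open>
  The generating function of a sum of independent variables is the product of the generating
  functions, in terms of formal power series.
\<close>

lemma (in prob_space) prob_sum_nat_vars:
  fixes X :: "nat \<Rightarrow> 'a \<Rightarrow> real" and b :: "nat \<Rightarrow> real"
  assumes indep: "indep_vars (\<lambda>_. borel) X {..<n}"
    and Nats: "\<And>i. i < n \<Longrightarrow> AE \<omega> in M. X i \<omega> \<in> \<nat>"
    and b: "\<And>i k. i < n \<Longrightarrow> prob {\<omega> \<in> space M. X i \<omega> = real k} = b k"
  assumes "m \<le> n"
  shows "Abs_fps (\<lambda>k. prob {\<omega> \<in> space M. (\<Sum>i<m. X i \<omega>) = real k}) = Abs_fps b ^ m"
  using \<open>m \<le> n\<close>
proof (induction m)
  case 0
  show ?case by (rule fps_ext) (auto simp: prob_space)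
next
  case (Suc m)
  define S where "S \<omega> = (\<Sum>i<m. X i \<omega>)" for \<omega>
  have rv [measurable]: "X i \<in> borel_measurable M" if "i < n" for i
    using indep that by (auto simp: indep_vars_def)
  have S_rv [measurable]: "S \<in> borel_measurable M"
    unfolding S_def[abs_def] using Suc.prems by (intro borel_measurable_sum rv) auto
  have Xm_rv [measurable]: "X m \<in> borel_measurable M"
    using Suc.prems by (intro rv) auto
  have "indep_vars (\<lambda>_. borel) X (insert m {..<m})"
    using indep by (rule indep_vars_subset) (use Suc.prems in auto)
  then have iv: "indep_var borel (X m) borel S"
    unfolding S_def[abs_def] by (intro indep_vars_sum) auto
  show ?case
  proof (rule fps_ext)
    fix k
    let ?E = "\<lambda>i. {\<omega> \<in> space M. X m \<omega> = real i \<and> S \<omega> = real (k - i)}"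
    have "AE \<omega> in M. \<forall>i\<in>{..<n}. X i \<omega> \<in> \<nat>"
      using Nats by (intro AE_finite_allI) auto
    then have "AE \<omega> in M. \<omega> \<in> {\<omega> \<in> space M. (\<Sum>i<Suc m. X i \<omega>) = real k} \<longleftrightarrow> \<omega> \<in> (\<Union>i\<in>{..k}. ?E i)"
      using AE_space
    proof eventually_elim
      case (elim \<omega>)
      have "X m \<omega> \<in> \<nat>" "S \<omega> \<in> \<nat>"
        using elim Suc.prems by (auto simp: S_def intro!: sum_in_Nats)
      then obtain i j where ij: "X m \<omega> = real i" "S \<omega> = real j"
        by (auto elim!: Nats_cases)
      have "(\<Sum>i<Suc m. X i \<omega>) = real (i + j)"
        using ij by (simp add: S_def)
      then have "\<omega> \<in> {\<omega> \<in> space M. (\<Sum>i<Suc m. X i \<omega>) = real k} \<longleftrightarrow> i + j = k"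
        using elim by (simp only: of_nat_eq_iff mem_Collect_eq simp_thms)
      also have "\<dots> \<longleftrightarrow> \<omega> \<in> (\<Union>i\<in>{..k}. ?E i)"
        using ij elim by auto
      finally show ?case .
    qed
    then have "prob {\<omega> \<in> space M. (\<Sum>i<Suc m. X i \<omega>) = real k} = prob (\<Union>i\<in>{..k}. ?E i)"
      using Suc.prems by (intro measure_eq_AE) auto
    also have "\<dots> = (\<Sum>i\<le>k. prob (?E i))"
      by (intro finite_measure_finite_Union) (auto simp: disjoint_family_on_def)
    also have "\<dots> = (\<Sum>i\<le>k. b i * prob {\<omega> \<in> space M. S \<omega> = real (k - i)})"
    proof (rule sum.cong)
      fix i
      have "prob (?E i) = prob ((\<lambda>x. (X m x, S x)) -` ({real i} \<times> {real (k - i)}) \<inter> space M)"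
        by (rule arg_cong[where f = prob]) auto
      also have "\<dots> = prob (X m -` {real i} \<inter> space M) * prob (S -` {real (k - i)} \<inter> space M)"
        by (rule indep_varD[OF iv]) auto
      also have "X m -` {real i} \<inter> space M = {\<omega> \<in> space M. X m \<omega> = real i}" by auto
      also have "S -` {real (k - i)} \<inter> space M = {\<omega> \<in> space M. S \<omega> = real (k - i)}" by auto
      finally show "prob (?E i) = b i * prob {\<omega> \<in> space M. S \<omega> = real (k - i)}"
        using b[of m i] Suc.prems by simp
    qed simp
    also have "\<dots> = fps_nth (Abs_fps b * Abs_fps (\<lambda>k. prob {\<omega> \<in> space M. S \<omega> = real k})) k"
      by (simp add: fps_mult_nth atLeast0AtMost)
    also have "\<dots> = fps_nth (Abs_fps b ^ Suc m) k"
      using Suc by (simp add: S_def)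
    finally show "fps_nth (Abs_fps (\<lambda>k. prob {\<omega> \<in> space M. (\<Sum>i<Suc m. X i \<omega>) = real k})) k =
        fps_nth (Abs_fps b ^ Suc m) k" by simp
  qed
qed

text \<open>
  A convolution root of a law on the natural numbers that charges 0 is again such a law. All
  coordinates being negative would make the sum negative, so the root lives on the nonnegative
  half-line. Then the sum vanishes only if all coordinates do, so the root charges 0. Finally one
  coordinate outside the natural numbers and zeros elsewhere would take the sum outside.
\<close>

lemma nat_convolution_root:
  fixes q :: "nat \<Rightarrow> real"
  assumes \<nu>: "real_distribution \<nu>" and n: "n \<ge> 1"
    and \<mu>: "\<mu> = distr (Pi\<^sub>M {..<n::nat} (\<lambda>_. \<nu>)) borel (\<lambda>x. \<Sum>i<n. x i)"
    and q: "\<And>k. measure \<mu> {real k} = q k" and q0: "q 0 > 0" and supp: "AE x in \<mu>. x \<in> \<nat>"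
  obtains b where "\<And>k. b k \<ge> 0" "\<And>k. k \<ge> 1 \<Longrightarrow> b k \<le> 1 - b 0" "Abs_fps b ^ n = Abs_fps q"
proof -
  interpret \<nu>: real_distribution \<nu> by fact
  let ?P = "Pi\<^sub>M {..<n} (\<lambda>_. \<nu>)"
  interpret P: prob_space ?P by (rule prob_space_PiM) (rule \<nu>.prob_space_axioms)
  have "P.indep_vars (\<lambda>_. \<nu>) (\<lambda>i x. x i) {..<n}"
    using n by (intro indep_vars_PiM_coordinates \<nu>.prob_space_axioms) (auto simp: lessThan_empty_iff)
  then have indep: "P.indep_vars (\<lambda>_. borel) (\<lambda>i x. x i) {..<n}"
    by (rule P.indep_vars_compose2[where Y = "\<lambda>_ x. x"]) simp
  have rv [measurable]: "(\<lambda>x. x i) \<in> borel_measurable ?P" if "i < n" for i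
    using indep that by (auto simp: P.indep_vars_def)
  have S_rv [measurable]: "(\<lambda>x. \<Sum>i<n. x i) \<in> borel_measurable ?P"
    by (intro borel_measurable_sum rv) auto
  have coord: "P.prob {x \<in> space ?P. x i \<in> A} = \<nu>.prob A" if "i < n" "A \<in> sets borel" for i A
  proof -
    have "\<nu>.prob A = measure (distr ?P \<nu> (\<lambda>x. x i)) A"
      using that by (subst distr_PiM_component) (auto simp: \<nu>.prob_space_axioms)
    also have "\<dots> = P.prob {x \<in> space ?P. x i \<in> A}"
      using that by (subst measure_distr) (auto intro!: arg_cong[where f = P.prob])
    finally show ?thesis ..
  qed
  have box: "P.prob {x \<in> space ?P. \<forall>i<n. x i \<in> A i} = (\<Prod>i<n. \<nu>.prob (A i))"
    if "\<And>i. A i \<in> sets borel" for A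
  proof -
    have ne: "{..<n} \<noteq> {}" using n by (auto simp: lessThan_empty_iff)
    then have "{x \<in> space ?P. \<forall>i<n. x i \<in> A i} = (\<Inter>i\<in>{..<n}. (\<lambda>x. x i) -` A i \<inter> space ?P)"
      by blast
    then have "P.prob {x \<in> space ?P. \<forall>i<n. x i \<in> A i} =
        (\<Prod>i<n. P.prob ((\<lambda>x. x i) -` A i \<inter> space ?P))"
      using that by (simp only:) (intro P.indep_varsD_finite[OF indep ne], auto)
    also have "\<dots> = (\<Prod>i<n. \<nu>.prob (A i))"
      using coord that by (intro prod.cong refl) (auto simp: vimage_def Int_def conj_commute)
    finally show ?thesis .
  qed
  have \<mu>_S: "measure \<mu> A = P.prob {x \<in> space ?P. (\<Sum>i<n. x i) \<in> A}" if "A \<in> sets borel" for A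
    using that unfolding \<mu> by (subst measure_distr) (auto intro!: arg_cong[where f = P.prob])
  have S_Nats: "AE x in ?P. (\<Sum>i<n. x i) \<in> \<nat>"
    using supp unfolding \<mu> by (subst (asm) AE_distr_iff) auto
  have box_0: "P.prob {x \<in> space ?P. \<forall>i<n. x i \<in> A i} = 0"
    if "\<And>i. A i \<in> sets borel" "\<And>x. (\<forall>i<n. x i \<in> A i) \<Longrightarrow> (\<Sum>i<n. x i) \<notin> \<nat>" for A
  proof (subst P.prob_eq_0)
    show "AE x in ?P. x \<notin> {x \<in> space ?P. \<forall>i<n. x i \<in> A i}"
      using S_Nats by eventually_elim (use that(2) in auto)
    show "{x \<in> space ?P. \<forall>i<n. x i \<in> A i} \<in> P.events"
      using that(1) by measurable
  qed
  have neg: "\<nu>.prob {..<0} = 0"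
  proof -
    have "P.prob {x \<in> space ?P. \<forall>i<n. x i \<in> {..<0}} = 0"
    proof (rule box_0)
      fix x :: "nat \<Rightarrow> real" assume "\<forall>i<n. x i \<in> {..<0}"
      then have "(\<Sum>i<n. x i) < 0"
        using n sum_strict_mono[of "{..<n}" x "\<lambda>_. 0"] by (auto simp: lessThan_empty_iff)
      then show "(\<Sum>i<n. x i) \<notin> \<nat>" by (auto elim!: Nats_cases)
    qed auto
    then show ?thesis using box[of "\<lambda>_. {..<0}"] by simp
  qed
  have nonneg: "AE x in ?P. \<forall>i\<in>{..<n}. x i \<ge> 0"
  proof (intro AE_finite_allI)
    fix i assume "i \<in> {..<n}"
    then have "P.prob {x \<in> space ?P. x i \<in> {..<0}} = 0"
      using neg coord[of i "{..<0}"] by simp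
    then show "AE x in ?P. x i \<ge> 0"
      using \<open>i \<in> {..<n}\<close> by (subst (asm) P.prob_eq_0) (auto simp: not_less)
  qed auto
  have atom: "\<nu>.prob {0} > 0"
  proof -
    have "q 0 = P.prob {x \<in> space ?P. (\<Sum>i<n. x i) = 0}"
      using \<mu>_S[of "{0}"] q[of 0] by simp
    also have "\<dots> \<le> P.prob {x \<in> space ?P. \<forall>i<n. x i \<in> {0}}"
    proof (intro P.finite_measure_mono_AE)
      show "AE x in ?P. x \<in> {x \<in> space ?P. (\<Sum>i<n. x i) = 0} \<longrightarrow> x \<in> {x \<in> space ?P. \<forall>i<n. x i \<in> {0}}"
        using nonneg
      proof eventually_elim
        case (elim x)
        then show ?case using sum_nonneg_eq_0_iff[of "{..<n}" x] by auto
      qed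
      show "{x \<in> space ?P. \<forall>i<n. x i \<in> {0}} \<in> P.events" by measurable
    qed
    also have "\<dots> = \<nu>.prob {0} ^ n"
      by (subst box) auto
    finally have "\<nu>.prob {0} ^ n > 0" using q0 by linarith
    then show ?thesis using n by (auto simp: zero_less_measure_iff power_0_left)
  qed
  have "\<nu>.prob (- \<nat>) = 0"
  proof -
    define A where "A i = (if i = (0::nat) then - \<nat> else {0::real})" for i
    have "P.prob {x \<in> space ?P. \<forall>i<n. x i \<in> A i} = 0"
    proof (rule box_0)
      show "A i \<in> sets borel" for i by (auto simp: A_def)
      fix x assume x: "\<forall>i<n. x i \<in> A i"
      have x0: "x 0 \<notin> \<nat>" using x[rule_format, of 0] n by (simp add: A_def)
      have xi: "x i = 0" if "i < n" "i \<noteq> 0" for i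
        using x[rule_format, of i] that by (simp add: A_def)
      have "(\<Sum>i<n. x i) = x 0 + (\<Sum>i\<in>{..<n} - {0}. x i)"
        using n by (intro sum.remove) auto
      also have "(\<Sum>i\<in>{..<n} - {0}. x i) = 0"
        using xi by (intro sum.neutral) auto
      finally show "(\<Sum>i<n. x i) \<notin> \<nat>" using x0 by simp
    qed
    then have "(\<Prod>i<n. \<nu>.prob (A i)) = 0"
      by (subst (asm) box) (auto simp: A_def)
    then show ?thesis using atom by (auto simp: A_def split: if_splits)
  qed
  then have coord_Nats: "AE x in ?P. x i \<in> \<nat>" if "i < n" for i
  proof -
    have "P.prob {x \<in> space ?P. x i \<in> - \<nat>} = 0"
      using coord[of i "- \<nat>"] that \<open>\<nu>.prob (- \<nat>) = 0\<close> by simp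
    then show ?thesis
      using that by (subst (asm) P.prob_eq_0) auto
  qed
  define b where "b k = \<nu>.prob {real k}" for k
  have "Abs_fps (\<lambda>k. P.prob {x \<in> space ?P. (\<Sum>i<n. x i) = real k}) = Abs_fps b ^ n"
    by (rule P.prob_sum_nat_vars[OF indep coord_Nats])
      (use coord[of _ "{real _}"] in \<open>auto simp: b_def\<close>)
  moreover have "P.prob {x \<in> space ?P. (\<Sum>i<n. x i) = real k} = q k" for k
    using \<mu>_S[of "{real k}"] q[of k] by simp
  ultimately have "Abs_fps b ^ n = Abs_fps q" by simp
  moreover have "b k \<le> 1 - b 0" if "k \<ge> 1" for k
  proof -
    have "b k + b 0 = \<nu>.prob ({real k} \<union> {0})"
      using that unfolding b_def by (subst \<nu>.finite_measure_Union) auto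
    also have "\<dots> \<le> 1" by simp
    finally show ?thesis by simp
  qed
  ultimately show ?thesis
    using that[of b] by (simp add: b_def)
qed

text \<open>
  Let \<open>B n\<close> be the generating function of the \<open>n\<close>-th convolution root of \<open>\<mu>\<close>. From \<open>Q = B n ^ n\<close> one gets
  \<open>L * B n = n * (B n)'\<close> for \<open>L = Q' / Q\<close>, and the right-hand side has nonnegative coefficients.
  As \<open>n\<close> tends to infinity, the roots concentrate at 0, so \<open>B n\<close> tends to 1 coefficientwise and
  the coefficients of \<open>L\<close> are limits of nonnegative numbers.
\<close>

lemma infinitely_divisible_log_derivative_nonneg:
  fixes q :: "nat \<Rightarrow> real"
  assumes id: "infinitely_divisible \<mu>"
    and q: "\<And>k. measure \<mu> {real k} = q k" and q0: "q 0 > 0" and supp: "AE x in \<mu>. x \<in> \<nat>"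
  obtains L where "\<And>k. fps_nth L k \<ge> 0" "fps_deriv (Abs_fps q) = L * Abs_fps q"
proof -
  define Q where "Q = Abs_fps q"
  define L where "L = fps_deriv Q * inverse Q"
  have Q0: "fps_nth Q 0 \<noteq> 0" using q0 by (simp add: Q_def)
  then have Q_nz: "Q \<noteq> 0" by auto
  have LQ: "fps_deriv Q = L * Q"
    using Q0 by (simp add: L_def mult.assoc inverse_mult_eq_1)
  have "\<forall>n. \<exists>b. n \<ge> 1 \<longrightarrow> (\<forall>k. b k \<ge> 0) \<and> (\<forall>k\<ge>1. b k \<le> 1 - b 0) \<and> Abs_fps b ^ n = Q"
  proof
    fix n :: nat
    show "\<exists>b. n \<ge> 1 \<longrightarrow> (\<forall>k. b k \<ge> 0) \<and> (\<forall>k\<ge>1. b k \<le> 1 - b 0) \<and> Abs_fps b ^ n = Q"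
    proof (cases "n \<ge> 1")
      case True
      then obtain \<nu> where "real_distribution \<nu>"
          "\<mu> = distr (Pi\<^sub>M {..<n::nat} (\<lambda>_. \<nu>)) borel (\<lambda>x. \<Sum>i<n. x i)"
        using id by (auto simp: infinitely_divisible_def)
      from nat_convolution_root[OF this(1) True this(2) q q0 supp] obtain b
        where "\<And>k. b k \<ge> 0" "\<And>k. k \<ge> 1 \<Longrightarrow> b k \<le> 1 - b 0" "Abs_fps b ^ n = Abs_fps q"
        by blast
      then show ?thesis
        unfolding Q_def by (intro exI[of _ b]) simp
    qed simp
  qed
  from choice[OF this] obtain b where b: "\<And>n k. n \<ge> 1 \<Longrightarrow> b n k \<ge> 0"
      "\<And>n k. n \<ge> 1 \<Longrightarrow> k \<ge> 1 \<Longrightarrow> b n k \<le> 1 - b n 0" "\<And>n. n \<ge> 1 \<Longrightarrow> Abs_fps (b n) ^ n = Q"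
    by blast
  have b0_lim: "(\<lambda>n. b n 0) \<longlonglongrightarrow> 1"
  proof -
    have "b n 0 = root n (q 0)" if "n \<ge> 1" for n
    proof -
      have "b n 0 ^ n = q 0"
        using arg_cong[OF b(3)[OF that], of "\<lambda>f. fps_nth f 0"]
        by (simp add: Q_def fps_power_zeroth)
      then show ?thesis using b(1)[OF that, of 0] that real_root_power_cancel[of n "b n 0"] by simp
    qed
    then have "\<forall>\<^sub>F n in sequentially. root n (q 0) = b n 0"
      by (intro eventually_sequentiallyI[of 1]) simp
    with LIMSEQ_root_const[OF q0] show ?thesis by (rule Lim_transform_eventually)
  qed
  have bk_lim: "(\<lambda>n. b n k) \<longlonglongrightarrow> 0" if "k \<ge> 1" for k
  proof (rule tendsto_sandwich)
    show "\<forall>\<^sub>F n in sequentially. 0 \<le> b n k" "\<forall>\<^sub>F n in sequentially. b n k \<le> 1 - b n 0"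
      using b that by (auto intro!: eventually_sequentiallyI[of 1])
    show "(\<lambda>n. 1 - b n 0) \<longlonglongrightarrow> 0"
      using tendsto_diff[OF tendsto_const[of 1] b0_lim] by simp
  qed simp
  have LB: "L * Abs_fps (b n) = of_nat n * fps_deriv (Abs_fps (b n))" if n: "n \<ge> 1" for n
  proof -
    let ?B = "Abs_fps (b n)"
    have "Q * (L * ?B) = fps_deriv (?B ^ n) * ?B"
      unfolding b(3)[OF n] LQ by (simp add: mult_ac)
    also have "\<dots> = of_nat n * fps_deriv ?B * (?B ^ (n - 1) * ?B)"
      by (simp add: fps_deriv_power mult_ac fps_of_nat)
    also have "?B ^ (n - 1) * ?B = Q"
      using n b(3)[OF n] by (simp add: power_eq_if mult.commute)
    finally have "Q * (L * ?B) = Q * (of_nat n * fps_deriv ?B)"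
      by (simp add: mult_ac)
    then show ?thesis using Q_nz by simp
  qed
  have "fps_nth L k \<ge> 0" for k
  proof -
    have "(\<lambda>n. \<Sum>i\<le>k. fps_nth L i * b n (k - i)) \<longlonglongrightarrow> (\<Sum>i\<le>k. fps_nth L i * (if i = k then 1 else 0))"
      by (intro tendsto_sum tendsto_mult_left) (use b0_lim bk_lim in auto)
    also have "(\<Sum>i\<le>k. fps_nth L i * (if i = k then 1 else 0)) = fps_nth L k"
      by (simp add: if_distrib cong: if_cong)
    finally have lim: "(\<lambda>n. \<Sum>i\<le>k. fps_nth L i * b n (k - i)) \<longlonglongrightarrow> fps_nth L k" .
    have "(\<Sum>i\<le>k. fps_nth L i * b n (k - i)) \<ge> 0" if "n \<ge> 1" for n
    proof -
      have "(\<Sum>i\<le>k. fps_nth L i * b n (k - i)) = fps_nth (L * Abs_fps (b n)) k"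
        by (simp add: fps_mult_nth atLeast0AtMost)
      also have "\<dots> = real n * ((real k + 1) * b n (k + 1))"
        unfolding LB[OF that] by (simp add: fps_of_nat [symmetric] fps_mult_left_const_nth)
      also have "\<dots> \<ge> 0" using b(1)[OF that] by simp
      finally show ?thesis .
    qed
    then show ?thesis
      by (intro tendsto_lowerbound[OF lim] eventually_sequentiallyI[of 1]) auto
  qed
  then show ?thesis by (rule that[of L]) (use LQ in \<open>simp add: Q_def\<close>)
qed

section \<open>The growth contradiction\<close>

lemma summable_power_le_real:
  fixes c :: "nat \<Rightarrow> real"
  assumes "\<And>n. c n \<ge> 0" "summable (\<lambda>n. c n * r ^ n)" "\<bar>y\<bar> \<le> r"
  shows "summable (\<lambda>n. norm (c n * y ^ n))"
  using assms(2)
  by (rule summable_comparison_test')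
    (use assms in \<open>auto simp: abs_mult power_abs intro!: mult_left_mono power_mono\<close>)

text \<open>
  The equation \<open>Q' = L * Q\<close> bounds the coefficients of \<open>L\<close> by those of \<open>Q' / q 0\<close>, since all the other
  terms of the convolution are nonnegative. So \<open>L\<close> converges wherever \<open>Q\<close> does, and the formal
  equation can be integrated as a differential equation.
\<close>

lemma power_series_eq_exp:
  fixes q :: "nat \<Rightarrow> real"
  assumes q: "\<And>n. q n \<ge> 0" "q 0 > 0" "\<And>r. r \<ge> R \<Longrightarrow> summable (\<lambda>n. q n * r ^ n)"
    and L: "\<And>k. fps_nth L k \<ge> 0" "fps_deriv (Abs_fps q) = L * Abs_fps q"
  shows "summable (\<lambda>k. fps_nth L k / real (Suc k) * r ^ Suc k)" (is "?A r")
    and "(\<Sum>n. q n * r ^ n) = q 0 * exp (\<Sum>k. fps_nth L k / real (Suc k) * r ^ Suc k)" (is "?B r")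
proof -
  have q_abs: "summable (\<lambda>n. norm (q n * y ^ n))" for y
    by (rule summable_power_le_real[OF q(1) q(3)[of "max R \<bar>y\<bar>"]]) auto
  have q_sum: "summable (\<lambda>n. q n * y ^ n)" for y
    using q_abs by (rule summable_norm_cancel)
  have dq: "diffs q k = (\<Sum>i\<le>k. fps_nth L i * q (k - i))" for k
    using arg_cong[OF L(2), of "\<lambda>f. fps_nth f k"]
    by (simp add: diffs_def fps_mult_nth atLeast0AtMost add.commute)
  have dq_sum: "summable (\<lambda>k. diffs q k * y ^ k)" for y
    by (rule termdiff_converges_all) (rule q_sum)
  have L_le: "fps_nth L k * q 0 \<le> diffs q k" for k
  proof -
    have "fps_nth L k * q (k - k) \<le> (\<Sum>i\<le>k. fps_nth L i * q (k - i))"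
      using L(1) q(1) by (intro member_le_sum) auto
    then show ?thesis by (simp add: dq)
  qed
  have L_abs: "summable (\<lambda>k. norm (fps_nth L k * y ^ k))" for y
  proof (rule summable_power_le_real[OF L(1) _ order_refl])
    show "summable (\<lambda>k. fps_nth L k * \<bar>y\<bar> ^ k)"
    proof (rule summable_comparison_test')
      show "summable (\<lambda>k. 1 / q 0 * (diffs q k * \<bar>y\<bar> ^ k))"
        by (intro summable_mult dq_sum)
      fix k
      have "fps_nth L k \<le> diffs q k / q 0"
        using L_le[of k] q(2) by (simp add: field_simps)
      then have "fps_nth L k * \<bar>y\<bar> ^ k \<le> diffs q k / q 0 * \<bar>y\<bar> ^ k"
        by (intro mult_right_mono) auto
      then show "norm (fps_nth L k * \<bar>y\<bar> ^ k) \<le> 1 / q 0 * (diffs q k * \<bar>y\<bar> ^ k)"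
        using L(1)[of k] by (simp add: abs_mult)
    qed
  qed
  define l where "l n = (if n = 0 then 0 else fps_nth L (n - 1) / real n)" for n
  have l_sum: "summable (\<lambda>n. l n * y ^ n)" for y
  proof (rule summable_comparison_test'[where N = 1])
    have "summable (\<lambda>k. \<bar>y\<bar> * norm (fps_nth L k * y ^ k))"
      by (intro summable_mult L_abs)
    then have "summable (\<lambda>k. norm (fps_nth L (Suc k - 1) * y ^ Suc k))"
      by (simp add: abs_mult mult_ac)
    then show "summable (\<lambda>n. norm (fps_nth L (n - 1) * y ^ n))"
      by (subst (asm) summable_Suc_iff)
    show "norm (l n * y ^ n) \<le> norm (fps_nth L (n - 1) * y ^ n)" if "n \<ge> 1" for n
    proof -
      have "fps_nth L (n - 1) / real n \<le> fps_nth L (n - 1) / 1"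
        using L(1) that by (intro divide_left_mono) auto
      then have "fps_nth L (n - 1) / real n * \<bar>y ^ n\<bar> \<le> fps_nth L (n - 1) / 1 * \<bar>y ^ n\<bar>"
        by (rule mult_right_mono) simp
      then show ?thesis using L(1)[of "n - 1"] that by (simp add: l_def abs_mult)
    qed
  qed
  define Qf where "Qf y = (\<Sum>n. q n * y ^ n)" for y
  define Pf where "Pf y = (\<Sum>n. l n * y ^ n)" for y
  define Lf where "Lf y = (\<Sum>k. fps_nth L k * y ^ k)" for y
  have dP: "(Pf has_real_derivative Lf y) (at y)" for y
  proof -
    have "(Pf has_real_derivative (\<Sum>n. diffs l n * y ^ n)) (at y)"
      unfolding Pf_def[abs_def] by (rule termdiffs_strong_converges_everywhere) (rule l_sum)
    moreover have "diffs l n = fps_nth L n" for n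
      by (simp add: diffs_def l_def)
    ultimately show ?thesis by (simp add: Lf_def)
  qed
  have dQ: "(Qf has_real_derivative Lf y * Qf y) (at y)" for y
  proof -
    have "(Qf has_real_derivative (\<Sum>n. diffs q n * y ^ n)) (at y)"
      unfolding Qf_def[abs_def] by (rule termdiffs_strong_converges_everywhere) (rule q_sum)
    also have "(\<Sum>n. diffs q n * y ^ n) = (\<Sum>n. \<Sum>i\<le>n. (fps_nth L i * y ^ i) * (q (n - i) * y ^ (n - i)))"
    proof (rule suminf_cong)
      fix n
      have "fps_nth L i * q (n - i) * y ^ n = (fps_nth L i * y ^ i) * (q (n - i) * y ^ (n - i))"
        if "i \<le> n" for i
        using that power_add[of y i "n - i"] by simp
      then show "diffs q n * y ^ n = (\<Sum>i\<le>n. (fps_nth L i * y ^ i) * (q (n - i) * y ^ (n - i)))"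
        unfolding dq sum_distrib_right by (intro sum.cong) auto
    qed
    also have "\<dots> = Lf y * Qf y"
      unfolding Lf_def Qf_def by (rule Cauchy_product [symmetric]) (rule L_abs q_abs)+
    finally show ?thesis .
  qed
  have "((\<lambda>y. Qf y * exp (- Pf y)) has_real_derivative 0) (at y)" for y
    by (rule derivative_eq_intros dP dQ refl | simp)+
  then have "Qf r * exp (- Pf r) = Qf 0 * exp (- Pf 0)" for r
    by (intro DERIV_isconst_all) auto
  moreover have "Qf 0 = q 0" "Pf 0 = 0"
    unfolding Qf_def Pf_def by (simp_all add: powser_zero l_def)
  ultimately have "Qf r = q 0 * exp (Pf r)" for r
    by (simp add: exp_minus field_simps)
  moreover have split: "Pf r = (\<Sum>k. fps_nth L k / real (Suc k) * r ^ Suc k)" for r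
    using suminf_split_head[OF l_sum[of r]] by (simp add: Pf_def l_def)
  ultimately show "?B r" by (simp add: Qf_def)
  show "?A r"
    using l_sum[of r] by (subst (asm) summable_Suc_iff [symmetric]) (simp add: l_def)
qed

text \<open>
  Replacing \<open>w ^ (2 n + 1)\<close> by \<open>w ^ (2 n)\<close> in the odd terms of the fractional Poisson generating
  function costs at most a factor \<open>w\<close>. In this way nothing has to be known about \<open>ml\<close> far out on the
  negative half-line, although an exact formula for this generating function would involve its
  values there.
\<close>

lemma renewal_pgf_bounds:
  assumes \<alpha>: "0 < \<alpha>" "\<alpha> \<le> 1" and x: "x > 0" and w: "w \<ge> 1"
  defines "q \<equiv> \<lambda>n. fpp_pmf \<alpha> (2 * n) x + fpp_pmf \<alpha> (2 * n + 1) x"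
  shows "summable (\<lambda>n. q n * (w\<^sup>2) ^ n)"
    and "(\<Sum>n. q n * (w\<^sup>2) ^ n) \<le> ml \<alpha> (x * (w - 1))"
    and "ml \<alpha> (x * (w - 1)) \<le> w * (\<Sum>n. q n * (w\<^sup>2) ^ n)"
proof -
  define g where "g n = fpp_pmf \<alpha> (2 * n) x * w ^ (2 * n) + fpp_pmf \<alpha> (2 * n + 1) x * w ^ (2 * n + 1)" for n
  have "(\<lambda>n. \<Sum>k\<in>{n * 2..<n * 2 + 2}. fpp_pmf \<alpha> k x * w ^ k) sums ml \<alpha> (x * (w - 1))"
    by (rule sums_group[OF fpp_pmf_sums[OF \<alpha>(1)]]) auto
  then have g: "g sums ml \<alpha> (x * (w - 1))"
    by (simp add: g_def[abs_def] numeral_2_eq_2 mult.commute)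
  have nn: "fpp_pmf \<alpha> k x \<ge> 0" for k by (rule fpp_pmf_nonneg[OF \<alpha> x])
  have odd_le: "w ^ (2 * n) \<le> w ^ (2 * n + 1)" for n
    using w by (intro power_increasing) auto
  have le: "q n * (w\<^sup>2) ^ n \<le> g n" and q_nonneg: "q n \<ge> 0" for n
    using nn mult_left_mono[OF odd_le[of n] nn[of "2 * n + 1"]]
    by (auto simp: q_def g_def distrib_right power_mult [symmetric])
  have ge: "g n \<le> w * (q n * (w\<^sup>2) ^ n)" for n
    using mult_left_mono[OF odd_le[of n] nn[of "2 * n"]]
    by (simp add: q_def g_def power_mult [symmetric] algebra_simps)
  show sm: "summable (\<lambda>n. q n * (w\<^sup>2) ^ n)"
    by (rule summable_comparison_test'[of g]) (use g le q_nonneg in \<open>auto simp: sums_iff\<close>)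
  show "(\<Sum>n. q n * (w\<^sup>2) ^ n) \<le> ml \<alpha> (x * (w - 1))"
    using suminf_le[OF le sm] g by (simp add: sums_iff)
  show "ml \<alpha> (x * (w - 1)) \<le> w * (\<Sum>n. q n * (w\<^sup>2) ^ n)"
    using suminf_le[OF ge _ summable_mult[OF sm]] g suminf_mult[OF sm, of w] by (simp add: sums_iff)
qed

text \<open>
  A power series \<open>P (w ^ 2)\<close> with nonnegative coefficients and only even powers of \<open>w\<close> would have to
  grow like \<open>\<kappa> * (w - 1) powr \<beta>\<close> up to a logarithmic error. It cannot match the leading term
  \<open>\<kappa> * w powr \<beta>\<close> and be smaller than it by the order of \<open>w powr (\<beta> - 1)\<close> at the same time.
\<close>

lemma renewal_pmf_log_derivative_not_nonneg:
  assumes \<alpha>: "0 < \<alpha>" "\<alpha> \<le> 1" and x: "x > 0"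
  defines "q \<equiv> \<lambda>n. fpp_pmf \<alpha> (2 * n) x + fpp_pmf \<alpha> (2 * n + 1) x"
  assumes L: "\<And>k. fps_nth L k \<ge> 0" "fps_deriv (Abs_fps q) = L * Abs_fps q"
  shows False
proof -
  define \<beta> where "\<beta> = 1 / \<alpha>"
  define \<kappa> where "\<kappa> = x powr \<beta>"
  have \<beta>: "\<beta> \<ge> 1" using \<alpha> by (simp add: \<beta>_def)
  have \<kappa>: "\<kappa> > 0" using x by (simp add: \<kappa>_def)
  have nn: "fpp_pmf \<alpha> k x \<ge> 0" for k by (rule fpp_pmf_nonneg[OF \<alpha> x])
  have q_nonneg: "q n \<ge> 0" for n using nn by (simp add: q_def)
  have q0: "q 0 > 0"
    using ml_neg_pos[OF \<alpha> x] nn[of 1] by (simp add: q_def fpp_pmf_0)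
  have q_sum: "summable (\<lambda>n. q n * r ^ n)" if "r \<ge> 1" for r
    using renewal_pgf_bounds(1)[OF \<alpha> x, of "sqrt r"] that by (simp add: q_def)
  define P where "P r = (\<Sum>k. fps_nth L k / real (Suc k) * r ^ Suc k)" for r
  note exp_P = power_series_eq_exp[OF q_nonneg q0 q_sum L]
  have P_sum: "summable (\<lambda>k. fps_nth L k / real (Suc k) * r ^ Suc k)" for r
    by (rule exp_P(1)) auto
  have Q_eq: "(\<Sum>n. q n * r ^ n) = q 0 * exp (P r)" for r
    unfolding P_def by (rule exp_P(2)) auto
  \<comment> \<open>In terms of \<open>t w\<close>, \<open>ml \<alpha>\<close> at \<open>x * (w - 1)\<close> is \<open>exp (t w)\<close> up to powers of \<open>t w\<close>.\<close>
  define t where "t w = \<kappa> * (w - 1) powr \<beta>" for w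
  have t_\<alpha>: "t w powr \<alpha> = x * (w - 1)" if "w \<ge> 1" for w
    using that x \<alpha> by (simp add: t_def \<kappa>_def \<beta>_def powr_mult powr_powr)
  have t_lim: "filterlim t at_top at_top"
    unfolding t_def[abs_def] using \<kappa> \<beta> by real_asymp
  define K where "K = real (nat \<lceil>1 / \<alpha>\<rceil>)"
  define C where "C = ln (2 * K) - ln (q 0)"
  have K: "K > 0" using \<alpha> by (simp add: K_def)
  have upper: "\<forall>\<^sub>F w in at_top. P (w\<^sup>2) \<le> t w + ln (t w) + C"
    using eventually_ge_at_top[of 1] eventually_compose_filterlim[OF eventually_ge_at_top[of 1] t_lim]
  proof eventually_elim
    case (elim w)
    have "q 0 * exp (P (w\<^sup>2)) \<le> ml \<alpha> (t w powr \<alpha>)"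
      using renewal_pgf_bounds(2)[OF \<alpha> x elim(1)] t_\<alpha>[OF elim(1)] Q_eq[of "w\<^sup>2"] by (simp add: q_def)
    also have "\<dots> \<le> K * (2 * t w * exp (t w))"
      unfolding K_def by (rule ml_le[OF \<alpha>(1) elim(2)])
    finally have "ln (q 0 * exp (P (w\<^sup>2))) \<le> ln (2 * K * t w * exp (t w))"
      using q0 elim K by (subst ln_le_cancel_iff) (auto simp: mult_ac)
    then show ?case using q0 elim K by (simp add: ln_mult C_def)
  qed
  have lower: "\<forall>\<^sub>F w in at_top. t w - 3 * ln (t w) - ln w - ln (q 0) \<le> P (w\<^sup>2)"
  proof -
    have "\<forall>\<^sub>F s in at_top. exp s / s ^ 3 \<le> (exp s - 1 - s) / (s\<^sup>2 :: real)"
      by real_asymp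
    from eventually_ge_at_top[of 1] eventually_compose_filterlim[OF eventually_ge_at_top[of 1] t_lim]
      eventually_compose_filterlim[OF this t_lim]
    show ?thesis
    proof eventually_elim
      case (elim w)
      have "exp (t w) / t w ^ 3 \<le> ml \<alpha> (t w powr \<alpha>)"
        using elim(3) ml_ge[OF \<alpha> elim(2)] by linarith
      also have "\<dots> \<le> w * (q 0 * exp (P (w\<^sup>2)))"
        using renewal_pgf_bounds(3)[OF \<alpha> x elim(1)] t_\<alpha>[OF elim(1)] Q_eq[of "w\<^sup>2"] by (simp add: q_def)
      finally have "ln (exp (t w) / t w ^ 3) \<le> ln (w * (q 0 * exp (P (w\<^sup>2))))"
        using q0 elim by (subst ln_le_cancel_iff) auto
      then show ?case using q0 elim by (simp add: ln_mult ln_div ln_realpow)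
    qed
  qed
  \<comment> \<open>A single term of \<open>P (w ^ 2)\<close> with an exponent above \<open>\<beta>\<close> would already break the upper bound.\<close>
  have degree: "fps_nth L k = 0" if k: "\<beta> < real (2 * Suc k)" for k
  proof -
    define \<gamma> where "\<gamma> = real (2 * Suc k)"
    define a where "a = fps_nth L k / real (Suc k)"
    have "\<forall>\<^sub>F w in at_top. a \<le> (t w + ln (t w) + C) / w powr \<gamma>"
      using upper eventually_gt_at_top[of 0]
    proof eventually_elim
      case (elim w)
      have "w powr \<gamma> = (w\<^sup>2) ^ Suc k"
        using elim unfolding \<gamma>_def by (simp only: powr_realpow power_mult)
      then have "a * w powr \<gamma> = fps_nth L k / real (Suc k) * (w\<^sup>2) ^ Suc k"
        by (simp add: a_def)
      also have "\<dots> = (\<Sum>j\<in>{k}. fps_nth L j / real (Suc j) * (w\<^sup>2) ^ Suc j)"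
        by simp
      also have "\<dots> \<le> P (w\<^sup>2)"
        unfolding P_def
        by (intro sum_le_suminf P_sum mult_nonneg_nonneg divide_nonneg_nonneg
            zero_le_power[OF zero_le_power2] L) auto
      finally show ?case using elim by (simp add: field_simps)
    qed
    moreover have "((\<lambda>w. (t w + ln (t w) + C) / w powr \<gamma>) \<longlongrightarrow> 0) at_top"
    proof -
      have "\<beta> < \<gamma>" using k by (simp add: \<gamma>_def)
      then show ?thesis unfolding t_def using \<kappa> \<beta> by real_asymp
    qed
    ultimately have "a \<le> 0"
      by (intro tendsto_lowerbound[of _ 0 at_top a]) auto
    then show ?thesis using L(1)[of k] by (simp add: a_def divide_le_0_iff)
  qed
  \<comment> \<open>All remaining exponents are at most \<open>\<beta>\<close>: \<open>P (w ^ 2) / w powr \<beta>\<close> is nonincreasing.\<close>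
  have scale: "P (v\<^sup>2) \<le> (v / w) powr \<beta> * P (w\<^sup>2)" if "0 < w" "w \<le> v" for v w
  proof -
    have "fps_nth L k / real (Suc k) * (v\<^sup>2) ^ Suc k \<le>
        (v / w) powr \<beta> * (fps_nth L k / real (Suc k) * (w\<^sup>2) ^ Suc k)" for k
    proof (cases "\<beta> < real (2 * Suc k)")
      case False
      have "(v\<^sup>2) ^ Suc k = (v / w) powr real (2 * Suc k) * (w\<^sup>2) ^ Suc k"
      proof -
        have "(v / w) powr real (2 * Suc k) = ((v / w)\<^sup>2) ^ Suc k"
          using that by (simp only: powr_realpow power_mult divide_pos_pos)
        then show ?thesis
          using that by (simp only: power_mult_distrib [symmetric] power_divide) simp
      qed
      also have "\<dots> \<le> (v / w) powr \<beta> * (w\<^sup>2) ^ Suc k"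
        using that False by (intro mult_right_mono powr_mono) auto
      finally have "fps_nth L k / real (Suc k) * (v\<^sup>2) ^ Suc k \<le>
          fps_nth L k / real (Suc k) * ((v / w) powr \<beta> * (w\<^sup>2) ^ Suc k)"
        by (intro mult_left_mono divide_nonneg_nonneg L) auto
      then show ?thesis by (simp only: mult_ac)
    qed (simp add: degree)
    then have "P (v\<^sup>2) \<le> (\<Sum>k. (v / w) powr \<beta> * (fps_nth L k / real (Suc k) * (w\<^sup>2) ^ Suc k))"
      unfolding P_def by (intro suminf_le P_sum summable_mult)
    then show ?thesis
      unfolding P_def by (simp only: suminf_mult[OF P_sum])
  qed
  have ge_\<kappa>: "\<kappa> * w powr \<beta> \<le> P (w\<^sup>2)" if w: "w > 0" for w
  proof -
    have "\<forall>\<^sub>F v in at_top. (t v - 3 * ln (t v) - ln v - ln (q 0)) / v powr \<beta> \<le> P (w\<^sup>2) / w powr \<beta>"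
      using lower eventually_ge_at_top[of w]
    proof eventually_elim
      case (elim v)
      have "t v - 3 * ln (t v) - ln v - ln (q 0) \<le> (v / w) powr \<beta> * P (w\<^sup>2)"
        using elim scale[OF w elim(2)] by linarith
      also have "\<dots> = v powr \<beta> * (P (w\<^sup>2) / w powr \<beta>)"
        using w elim by (simp add: powr_divide)
      finally show ?case using w elim by (simp add: field_simps)
    qed
    moreover have "((\<lambda>v. (t v - 3 * ln (t v) - ln v - ln (q 0)) / v powr \<beta>) \<longlongrightarrow> \<kappa>) at_top"
      unfolding t_def using \<kappa> \<beta> by real_asymp
    ultimately have "\<kappa> \<le> P (w\<^sup>2) / w powr \<beta>"
      by (intro tendsto_upperbound) auto
    then show ?thesis using w by (simp add: field_simps)
  qed
  show False
  proof (cases "\<beta> < 2")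
    case True
    then have "fps_nth L k = 0" for k by (intro degree) auto
    then have "P (1\<^sup>2) = 0" by (simp add: P_def)
    then show False using ge_\<kappa>[of 1] \<kappa> by simp
  next
    case False
    have "\<forall>\<^sub>F w in at_top. \<kappa> * w powr (\<beta> - 1) \<le> ln (t w) + C"
      using upper eventually_ge_at_top[of 1]
    proof eventually_elim
      case (elim w)
      have "((w - 1) / w) powr \<beta> \<le> ((w - 1) / w) powr 1"
        using elim \<beta> by (intro powr_mono') auto
      then have "(w - 1) powr \<beta> \<le> w powr \<beta> * ((w - 1) / w)"
        using elim by (simp add: powr_divide field_simps)
      also have "\<dots> = w powr \<beta> - w powr (\<beta> - 1)"
        using elim by (simp add: powr_diff field_simps)
      finally have "t w \<le> \<kappa> * w powr \<beta> - \<kappa> * w powr (\<beta> - 1)"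
        unfolding t_def using \<kappa> mult_left_mono[of _ _ \<kappa>] by (fastforce simp: right_diff_distrib)
      then show ?case using elim ge_\<kappa>[of w] by simp
    qed
    moreover have "\<forall>\<^sub>F w in at_top. ln (t w) + C < \<kappa> * w powr (\<beta> - 1)"
      unfolding t_def using \<kappa> False by real_asymp
    ultimately have "eventually (\<lambda>w :: real. False) at_top"
      by eventually_elim simp
    then show False by simp
  qed
qed

theorem proposition3p6:
  fixes M :: "'a measure" and T :: "nat \<Rightarrow> 'a \<Rightarrow> real" and lam \<alpha> :: real
  assumes "lam > 0" and "0 < \<alpha>" and "\<alpha> \<le> 1"
    and "prob_space M"
    and "prob_space.indep_vars M (\<lambda>_. borel) T UNIV"
    and "\<And>i. distributed M lborel (T i) (\<lambda>s. ennreal (interarrival_density lam \<alpha> s))"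
  shows "\<forall>t>0. \<not> infinitely_divisible (distr M borel (\<lambda>\<omega>. real (renewal_count T t \<omega>)))"
proof (intro allI impI notI)
  fix t :: real
  assume t: "t > 0"
    and id: "infinitely_divisible (distr M borel (\<lambda>\<omega>. real (renewal_count T t \<omega>)))"
  interpret ml_renewal M T lam \<alpha>
    by (rule ml_renewal.intro[OF assms(4)], unfold_locales) (use assms in auto)
  define x where "x = lam * t powr \<alpha>"
  define q where "q n = fpp_pmf \<alpha> (2 * n) x + fpp_pmf \<alpha> (2 * n + 1) x" for n
  have x: "x > 0" using assms t by (simp add: x_def)
  have meas [measurable]: "(\<lambda>\<omega>. real (renewal_count T t \<omega>)) \<in> borel_measurable M"
    by measurable
  have pmf: "measure (distr M borel (\<lambda>\<omega>. real (renewal_count T t \<omega>))) {real k} = q k" for k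
  proof -
    have "measure (distr M borel (\<lambda>\<omega>. real (renewal_count T t \<omega>))) {real k} =
        prob {\<omega> \<in> space M. renewal_count T t \<omega> = k}"
      by (subst measure_distr) (auto intro!: arg_cong[where f = prob])
    also have "\<dots> = q k"
      unfolding q_def x_def by (rule prob_renewal_count[OF t])
    finally show ?thesis .
  qed
  have "q 0 > 0"
    using ml_neg_pos[OF assms(2,3) x] fpp_pmf_nonneg[OF assms(2,3) x, of 1] by (simp add: q_def fpp_pmf_0)
  moreover have "AE y in distr M borel (\<lambda>\<omega>. real (renewal_count T t \<omega>)). y \<in> \<nat>"
    by (subst AE_distr_iff) auto
  ultimately obtain L where L: "\<And>k. fps_nth L k \<ge> 0" "fps_deriv (Abs_fps q) = L * Abs_fps q"
    using infinitely_divisible_log_derivative_nonneg[OF id pmf] by blast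
  show False
    by (rule renewal_pmf_log_derivative_not_nonneg[OF assms(2,3) x L(1)])
      (use L(2) in \<open>simp add: q_def[abs_def]\<close>)
qed

end
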